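(* For all integers $k>0$ and $\ell>0$ there exists an integer $f(k,\ell)<\infty$ such that Hamiltonian-$\ell$-Linkage can be solved in time $O(n^{f(k,\ell)})$ on input graphs $G$ with $n$ vertices and independence number $\alpha(G)<k$.
   Context: Graphs are finite, simple and undirected; $\alpha(G)$ is the independence number. Hamiltonian-$\ell$-Linkage: given a graph $G$ and distinct vertices $s_1,\dots,s_\ell,t_1,\dots,t_\ell\in V(G)$, decide whether there exist pairwise vertex-disjoint paths $P_1,\dots,P_\ell$ in $G$ such that $P_i$ has end-vertices $s_i$ and $t_i$ for each $i$ and $\bigcup_{i=1}^\ell V(P_i)=V(G)$. *)

theory Defs
  imports
    "Graph_Theory.Pair_Digraph"
    "Graph_Theory.Vertex_Walk"
    "HOL-Library.Disjoint_Sets"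
    "HOL-Library.Landau_Symbols"
begin

section \<open>Graphs of bounded independence number and Hamiltonian linkages\<close>

text \<open>
  A finite simple undirected graph is a \<open>pair_graph\<close>: its arc relation \<open>parcs G\<close> is finite,
  symmetric and irreflexive on \<open>pverts G\<close>, each undirected edge being present in both directions.
\<close>

definition independent_set :: "'a pair_pre_digraph \<Rightarrow> 'a set \<Rightarrow> bool" where
  "independent_set G S \<longleftrightarrow> S \<subseteq> pverts G \<and> (\<forall>u\<in>S. \<forall>v\<in>S. (u, v) \<notin> parcs G)"

definition independence_number :: "'a pair_pre_digraph \<Rightarrow> nat" where
  "independence_number G = Max (card ` {S. independent_set G S})"

definition hamiltonian_linkage :: "'a pair_pre_digraph \<Rightarrow> 'a list \<Rightarrow> 'a list \<Rightarrow> bool" where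
  "hamiltonian_linkage G ss ts \<longleftrightarrow>
     (\<exists>P :: nat \<Rightarrow> 'a list.
        (\<forall>i<length ss. vpath (P i) (with_proj G) \<and> hd (P i) = ss ! i \<and> last (P i) = ts ! i) \<and>
        disjoint_family_on (\<lambda>i. set (P i)) {..<length ss} \<and>
        (\<Union>i<length ss. set (P i)) = pverts G)"

text \<open>
  An instance consists of the graph and the two terminal lists \<open>s\<^sub>1, \<dots>, s\<^sub>l\<close> and
  \<open>t\<^sub>1, \<dots>, t\<^sub>l\<close> (indexed from 0). As an input to an algorithm the graph has its
  \<open>n\<close> vertices numbered \<open>0, \<dots>, n - 1\<close>.
\<close>

type_synonym linkage_instance = "nat pair_pre_digraph \<times> nat list \<times> nat list"

definition linkage_instances :: "nat \<Rightarrow> linkage_instance set" where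
  "linkage_instances l =
     {(G, ss, ts). pair_graph G \<and> pverts G = {..<card (pverts G)} \<and>
        length ss = l \<and> length ts = l \<and> distinct (ss @ ts) \<and> set (ss @ ts) \<subseteq> pverts G}"

fun instance_order :: "linkage_instance \<Rightarrow> nat" where
  "instance_order (G, ss, ts) = card (pverts G)"

section \<open>Random access machines\<close>

text \<open>
  Structured programs for a random access machine with unit cost. The memory consists of arrays
  of natural numbers, indexed by natural numbers; as array names are fixed in the program text,
  a program uses only finitely many arrays. The arithmetic operations are addition and truncated
  subtraction. Multiplication is deliberately not a unit-cost operation: without it, numbers of
  at most linearly many bits (in the running time and the input size) arise, so the model is
  polynomially equivalent to Turing machines.
\<close>

type_synonym memory = "nat \<Rightarrow> nat \<Rightarrow> nat"

datatype expr =
    Const nat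
  | Read nat expr
  | Plus expr expr
  | Minus expr expr

datatype program =
    Skip
  | Write nat expr expr
  | Seq program program
  | Cond expr program program
  | While expr program

primrec expr_val :: "expr \<Rightarrow> memory \<Rightarrow> nat" where
  "expr_val (Const c) m = c"
| "expr_val (Read a e) m = m a (expr_val e m)"
| "expr_val (Plus e1 e2) m = expr_val e1 m + expr_val e2 m"
| "expr_val (Minus e1 e2) m = expr_val e1 m - expr_val e2 m"

primrec expr_time :: "expr \<Rightarrow> nat" where
  "expr_time (Const c) = 1"
| "expr_time (Read a e) = 1 + expr_time e"
| "expr_time (Plus e1 e2) = 1 + expr_time e1 + expr_time e2"
| "expr_time (Minus e1 e2) = 1 + expr_time e1 + expr_time e2"

text \<open>
  \<open>exec p m t m'\<close>: started with memory \<open>m\<close>, program \<open>p\<close> halts after exactly \<open>t\<close> steps with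
  memory \<open>m'\<close>. \<open>Write a i e\<close> stores the value of \<open>e\<close> in cell \<open>i\<close> of array \<open>a\<close>; a test succeeds
  if its value is nonzero.
\<close>

inductive exec :: "program \<Rightarrow> memory \<Rightarrow> nat \<Rightarrow> memory \<Rightarrow> bool" where
  Skip: "exec Skip m 1 m"
| Write: "exec (Write a i e) m (1 + expr_time i + expr_time e)
            (m(a := (m a)(expr_val i m := expr_val e m)))"
| Seq: "exec p m t m' \<Longrightarrow> exec q m' t' m'' \<Longrightarrow> exec (Seq p q) m (t + t') m''"
| CondTrue: "expr_val b m \<noteq> 0 \<Longrightarrow> exec p m t m' \<Longrightarrow> exec (Cond b p q) m (1 + expr_time b + t) m'"
| CondFalse: "expr_val b m = 0 \<Longrightarrow> exec q m t m' \<Longrightarrow> exec (Cond b p q) m (1 + expr_time b + t) m'"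
| WhileFalse: "expr_val b m = 0 \<Longrightarrow> exec (While b p) m (1 + expr_time b) m"
| WhileTrue: "expr_val b m \<noteq> 0 \<Longrightarrow> exec p m t m' \<Longrightarrow> exec (While b p) m' t' m'' \<Longrightarrow>
     exec (While b p) m (1 + expr_time b + t + t') m''"

inductive_cases Skip_execE: "exec Skip m t m'"
inductive_cases Write_execE: "exec (Write a i e) m t m'"
inductive_cases Seq_execE: "exec (Seq p q) m t m'"
inductive_cases Cond_execE: "exec (Cond b p q) m t m'"
inductive_cases While_execE: "exec (While b p) m t m'"

lemma exec_deterministic:
  assumes "exec p m t m'" and "exec p m u m''"
  shows "u = t \<and> m'' = m'"
  using assms
proof (induction arbitrary: u m'' rule: exec.induct)
  case (Skip m)
  then show ?case by (auto elim: Skip_execE)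
next
  case (Write a i e m)
  then show ?case by (auto elim: Write_execE)
next
  case (Seq p m t m1 q t' m2)
  from Seq.prems show ?case
  proof (rule Seq_execE)
    fix t1 m3 t2
    assume u: "u = t1 + t2" and p: "exec p m t1 m3" and q: "exec q m3 t2 m''"
    from Seq.IH(1)[OF p] have "t1 = t" "m3 = m1" by blast+
    with Seq.IH(2) q u show ?thesis by simp
  qed
next
  case (CondTrue b m p t m' q)
  from CondTrue.prems show ?case
  proof (rule Cond_execE)
    fix t1
    assume u: "u = Suc (expr_time b + t1)" and p: "exec p m t1 m''"
    from CondTrue.IH[OF p] u show ?thesis by simp
  next
    assume "expr_val b m = 0"
    with CondTrue.hyps(1) show ?thesis by simp
  qed
next
  case (CondFalse b m q t m' p)
  from CondFalse.prems show ?case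
  proof (rule Cond_execE)
    assume "0 < expr_val b m"
    with CondFalse.hyps(1) show ?thesis by simp
  next
    fix t1
    assume u: "u = Suc (expr_time b + t1)" and q: "exec q m t1 m''"
    from CondFalse.IH[OF q] u show ?thesis by simp
  qed
next
  case (WhileFalse b m p)
  from WhileFalse.prems show ?case
  proof (rule While_execE)
    assume "u = Suc (expr_time b)" and "m'' = m"
    then show ?thesis by simp
  next
    assume "0 < expr_val b m"
    with WhileFalse.hyps show ?thesis by simp
  qed
next
  case (WhileTrue b m p t m1 t' m2)
  from WhileTrue.prems show ?case
  proof (rule While_execE)
    assume "expr_val b m = 0"
    with WhileTrue.hyps(1) show ?thesis by simp
  next
    fix t1 m3 t2
    assume u: "u = Suc (expr_time b + t1 + t2)"
      and p: "exec p m t1 m3" and w: "exec (While b p) m3 t2 m''"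
    from WhileTrue.IH(1)[OF p] have "t1 = t" "m3 = m1" by blast+
    with WhileTrue.IH(2) w u show ?thesis by simp
  qed
qed

text \<open>
  The decision problem asking for \<open>Q x\<close> on the inputs \<open>x \<in> I\<close> (a promise: the behaviour on other
  inputs is irrelevant) can be solved in time \<open>O(g)\<close>, where \<open>sz x\<close> is the parameter in which
  time is measured. The answer, 1 for yes and 0 for no, is returned in cell 0 of array 0.
\<close>

definition solvable_in_time ::
    "('i \<Rightarrow> memory) \<Rightarrow> ('i \<Rightarrow> nat) \<Rightarrow> 'i set \<Rightarrow> ('i \<Rightarrow> bool) \<Rightarrow> (nat \<Rightarrow> real) \<Rightarrow> bool" where
  "solvable_in_time encode sz I Q g \<longleftrightarrow>
     (\<exists>p :: program. \<exists>T :: nat \<Rightarrow> nat. (\<lambda>n. real (T n)) \<in> O(g) \<and>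
        (\<forall>x\<in>I. \<exists>t m. exec p (encode x) t m \<and> t \<le> T (sz x) \<and> m 0 0 = of_bool (Q x)))"

text \<open>
  Input format: cell 0 of array 0 holds the number \<open>n\<close> of vertices, array 1 the adjacency matrix
  in row-major order, arrays 2 and 3 the two terminal lists; all other cells are 0.
\<close>

fun encode_instance :: "linkage_instance \<Rightarrow> memory" where
  "encode_instance (G, ss, ts) =
     (let n = card (pverts G) in
      (\<lambda>_ _. 0)
        (0 := (\<lambda>_. 0)(0 := n),
         1 := (\<lambda>j. of_bool (j < n * n \<and> (j div n, j mod n) \<in> parcs G)),
         2 := (\<lambda>i. if i < length ss then ss ! i else 0),
         3 := (\<lambda>i. if i < length ts then ts ! i else 0)))"

end

theory Submission
  imports Defs
begin

text \<open>
  In a graph with independence number below \<open>k\<close>, any two vertices of a component are joined by a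
  path with at most \<open>2 * k\<close> vertices. If moreover the components stay connected after deleting any
  \<open>c\<close> vertices, with \<open>c\<close> large, then disjoint terminal pairs can always be linked by disjoint
  paths covering every component that contains a pair: short paths are found greedily, and a
  linkage with the most vertices covers everything.

  In general, a set \<open>A\<close> of boundedly many vertices can be deleted such that all components of
  the rest are robust in this sense, since every failure of robustness yields a further component
  and there are fewer than \<open>k\<close> of them. Hence a Hamiltonian linkage exists iff there is a
  skeleton of bounded size, recording how the paths pass through \<open>A\<close> and where they enter and
  leave the components. As reachability is witnessed by paths of bounded length, the existence of a
  robust \<open>A\<close> and a skeleton is a first-order property with a fixed number of quantified vertices,
  which nested loops decide in polynomial time.
\<close>

section \<open>Robustly connected vertex sets\<close>

text \<open>The obstacle is a circularity of constants: how robust the rest must be depends on the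
  size of a skeleton, which depends on the size of \<open>A\<close>, while demanding more robustness
  enlarges \<open>A\<close>. It is broken by letting the demand depend on the round:
  \<open>cut_bound k l j\<close> grows with the number \<open>j\<close> of separated components, and
  fewer than \<open>k\<close> of these can be separated. No particular \<open>A\<close> has to be
  computed, since every sufficiently robust \<open>A\<close> with a skeleton of bounded length is
  sound; the program may search through all candidates. The bound \<alpha>(G) < k enters three
  times: it bounds induced paths, which makes reachability first-order; it bounds the number of
  components; and it provides the edge used for rerouting a path. Vertices that a skeleton records
  singly are deleted before linking, so a component without a proper pair has to be exhausted by
  such vertices. The covering clause of \<open>skeleton\<close> expresses this. No program for the
  whole formula is written down: the predicates with polynomial-time tests are shown to be closed
  under connectives and vertex quantifiers.\<close>

definition reach :: "('a \<times> 'a) set \<Rightarrow> 'a set \<Rightarrow> 'a \<Rightarrow> 'a \<Rightarrow> bool" where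
  "reach E W u v \<longleftrightarrow> u \<in> W \<and> v \<in> W \<and> (u, v) \<in> (E \<inter> W \<times> W)\<^sup>*"

abbreviation chain :: "('a \<times> 'a) set \<Rightarrow> 'a list \<Rightarrow> bool" where
  "chain E \<equiv> successively (\<lambda>u v. (u, v) \<in> E)"

definition path_in :: "('a \<times> 'a) set \<Rightarrow> 'a set \<Rightarrow> 'a \<Rightarrow> 'a list \<Rightarrow> 'a \<Rightarrow> bool" where
  "path_in E W x xs y \<longleftrightarrow>
     xs \<noteq> [] \<and> hd xs = x \<and> last xs = y \<and> set xs \<subseteq> W \<and> distinct xs \<and> chain E xs"

lemma reach_trans: "reach E W u v \<Longrightarrow> reach E W v w \<Longrightarrow> reach E W u w"
  unfolding reach_def by auto

lemma reach_refl: "u \<in> W \<Longrightarrow> reach E W u u"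
  unfolding reach_def by auto

lemma reach_edge: "(u, v) \<in> E \<Longrightarrow> u \<in> W \<Longrightarrow> v \<in> W \<Longrightarrow> reach E W u v"
  unfolding reach_def by auto

lemma reach_mono:
  assumes "reach E W u v" "W \<subseteq> W'"
  shows "reach E W' u v"
proof -
  have "(E \<inter> W \<times> W)\<^sup>* \<subseteq> (E \<inter> W' \<times> W')\<^sup>*"
    using assms(2) by (intro rtrancl_mono) auto
  then show ?thesis using assms unfolding reach_def by blast
qed

lemma reach_in: "reach E W u v \<Longrightarrow> u \<in> W" "reach E W u v \<Longrightarrow> v \<in> W"
  unfolding reach_def by auto

lemma reach_sym:
  assumes "sym E" "reach E W u v"
  shows "reach E W v u"
proof -
  have "sym (E \<inter> W \<times> W)" using assms(1) by (auto simp: sym_def)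
  then have "sym ((E \<inter> W \<times> W)\<^sup>*)" by (rule sym_rtrancl)
  then show ?thesis using assms(2) unfolding reach_def by (auto dest: symD)
qed

lemma reach_induct [consumes 1, case_names refl step]:
  assumes "reach E W u v"
    and "P u"
    and "\<And>x y. reach E W u x \<Longrightarrow> P x \<Longrightarrow> y \<in> W \<Longrightarrow> (x, y) \<in> E \<Longrightarrow> P y"
  shows "P v"
proof -
  have *: "(u, v) \<in> (E \<inter> W \<times> W)\<^sup>*" and "u \<in> W" using assms(1) unfolding reach_def by auto
  from * have "P v \<and> reach E W u v"
  proof (induction rule: rtrancl_induct)
    case base
    then show ?case using assms(2) \<open>u \<in> W\<close> by (auto simp: reach_refl)
  next
    case (step y z)
    then have "reach E W y z" by (auto intro: reach_edge)
    then show ?case using step assms(3) reach_trans by (metis IntD1 IntD2 mem_Sigma_iff)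
  qed
  then show ?thesis ..
qed

lemma chain_reach:
  assumes "chain E xs" "set xs \<subseteq> W" "x \<in> set xs"
  shows "reach E W (hd xs) x"
  using assms
proof (induction xs rule: induct_list012)
  case (3 a b zs)
  show ?case
  proof (cases "x = a")
    case False
    then have "reach E W b x" using 3 by auto
    moreover have "reach E W a b" using 3 by (auto intro: reach_edge)
    ultimately show ?thesis by (auto intro: reach_trans)
  qed (use 3 in \<open>auto intro: reach_refl\<close>)
qed (auto intro: reach_refl)

lemma reach_chain:
  assumes "reach E W u v"
  shows "\<exists>xs. xs \<noteq> [] \<and> hd xs = u \<and> last xs = v \<and> set xs \<subseteq> W \<and> chain E xs"
  using assms
proof (induction rule: reach_induct)
  case refl
  then show ?case using assms reach_in by (intro exI[of _ "[u]"]) fastforce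
next
  case (step x y)
  then obtain xs where "xs \<noteq> []" "hd xs = u" "last xs = x" "set xs \<subseteq> W" "chain E xs" by blast
  then show ?case using step
    by (intro exI[of _ "xs @ [y]"]) (auto simp: successively_append_iff)
qed

locale graph_of_independence =
  fixes V :: "'a set" and E :: "('a \<times> 'a) set" and k :: nat
  assumes finite_V: "finite V"
    and sym_E: "sym E"
    and irrefl_E: "(u, u) \<notin> E"
    and independent_card: "S \<subseteq> V \<Longrightarrow> (\<And>u v. u \<in> S \<Longrightarrow> v \<in> S \<Longrightarrow> (u, v) \<notin> E) \<Longrightarrow> card S < k"
begin

text \<open>A shortest chain has neither chords nor repetitions. With more than \<open>2 * k\<close>
  vertices, its entries at the positions 0, 2, ..., \<open>2 * k - 2\<close> would be
  \<open>k\<close> independent vertices.\<close>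

lemma reach_short_path:
  assumes "reach E W u v" "W \<subseteq> V"
  shows "\<exists>xs. path_in E W u xs v \<and> length xs \<le> 2 * k"
proof -
  let ?P = "\<lambda>xs. xs \<noteq> [] \<and> hd xs = u \<and> last xs = v \<and> set xs \<subseteq> W \<and> chain E xs"
  obtain xs where xs: "?P xs" and least: "\<And>ys. ?P ys \<Longrightarrow> length xs \<le> length ys"
    using reach_chain[OF assms(1)] ex_has_least_nat[of ?P _ length] by blast
  have chord: "j = Suc i" if "i < j" "j < length xs" "(xs ! i, xs ! j) \<in> E" for i j
  proof -
    \<comment> \<open>The chord replaces the stretch between the positions \<open>i\<close> and
      \<open>j\<close>. As the result cannot be shorter than \<open>xs\<close>, nothing lies
      strictly between them.\<close>
    let ?ys = "take (Suc i) xs @ drop j xs"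
    have "?P ?ys"
    proof (intro conjI)
      have "chain E (take (Suc i) xs)" "chain E (drop j xs)"
        using xs append_take_drop_id[of "Suc i" xs] append_take_drop_id[of j xs]
        by (metis successively_append_iff)+
      moreover have "last (take (Suc i) xs) = xs ! i" "hd (drop j xs) = xs ! j"
        using that by (simp_all add: take_Suc_conv_app_nth hd_drop_conv_nth)
      ultimately show "chain E ?ys" using that by (simp add: successively_append_iff)
    qed (use xs that in \<open>auto dest: in_set_takeD in_set_dropD simp: hd_append\<close>)
    from least[OF this] show ?thesis using that by auto
  qed
  have "distinct xs"
  proof (rule ccontr)
    assume "\<not> distinct xs"
    then obtain as bs cs x where d: "xs = as @ [x] @ bs @ [x] @ cs"
      using not_distinct_decomp by blast
    let ?ys = "as @ [x] @ cs"
    have "?P ?ys" using xs d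
      by (cases as) (auto simp: successively_append_iff successively_Cons hd_append)
    from least[OF this] show False using d by simp
  qed
  have "length xs \<le> 2 * k"
  proof (rule ccontr)
    assume *: "\<not> ?thesis"
    let ?S = "(\<lambda>i. xs ! (2 * i)) ` {..<k}"
    have "card ?S = k"
      using \<open>distinct xs\<close> * by (subst card_image) (auto simp: inj_on_def nth_eq_iff_index_eq)
    have "(xs ! (2 * i), xs ! (2 * j)) \<notin> E" if "i < k" "j < k" for i j
    proof (cases i j rule: linorder_cases)
      case less
      then show ?thesis using chord[of "2 * i" "2 * j"] * that by auto
    next
      case equal
      then show ?thesis using irrefl_E by auto
    next
      case greater
      then show ?thesis using chord[of "2 * j" "2 * i"] * that sym_E by (auto dest: symD)
    qed
    then have "card ?S < k"
      using xs assms(2) * by (intro independent_card) (auto simp: subset_iff)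
    then show False using \<open>card ?S = k\<close> by simp
  qed
  then show ?thesis using xs \<open>distinct xs\<close> unfolding path_in_def by blast
qed

text \<open>
  Only pairs connected in \<open>W\<close> are considered, so this says that every component of \<open>W\<close> stays
  connected when at most \<open>c\<close> vertices are deleted.
\<close>

definition robust :: "nat \<Rightarrow> 'a set \<Rightarrow> bool" where
  "robust c W \<longleftrightarrow> (\<forall>B u v. card B \<le> c \<longrightarrow> B \<subseteq> V \<longrightarrow> u \<notin> B \<longrightarrow> v \<notin> B \<longrightarrow>
     reach E W u v \<longrightarrow> reach E (W - B) u v)"

lemma robust_anti: "robust c W \<Longrightarrow> c' \<le> c \<Longrightarrow> robust c' W"
  unfolding robust_def by force

text \<open>Deleting \<open>B\<close> and then \<open>C\<close> amounts to deleting
  \<open>B \<union> C\<close>, so the removal of \<open>B\<close> is paid for out of the robustness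
  budget. This is how single vertices of a skeleton are removed later.\<close>

lemma robust_diff:
  assumes "robust (c + card B) W" "B \<subseteq> V"
  shows "robust c (W - B)"
  unfolding robust_def
proof (intro allI impI)
  fix C u v
  assume C: "card C \<le> c" "C \<subseteq> V" "u \<notin> C" "v \<notin> C" and r: "reach E (W - B) u v"
  have "card (B \<union> C) \<le> c + card B" using C card_Un_le[of B C] by linarith
  moreover have "reach E W u v" using r by (rule reach_mono) auto
  ultimately have "reach E (W - (B \<union> C)) u v"
    using assms C reach_in[OF r] unfolding robust_def by blast
  then show "reach E (W - B - C) u v" by (simp add: Diff_eq Int_assoc)
qed

section \<open>Disjoint paths that cover a robust set\<close>

definition linked :: "'a set \<Rightarrow> ('a \<times> 'a) set \<Rightarrow> ('a \<times> 'a \<Rightarrow> 'a list) \<Rightarrow> bool" where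
  "linked W D F \<longleftrightarrow> (\<forall>p\<in>D. path_in E W (fst p) (F p) (snd p)) \<and>
     disjoint_family_on (\<lambda>p. set (F p)) D"

definition disjoint_pairs :: "('a \<times> 'a) set \<Rightarrow> bool" where
  "disjoint_pairs D \<longleftrightarrow> (\<forall>p\<in>D. \<forall>q\<in>D. p \<noteq> q \<longrightarrow> {fst p, snd p} \<inter> {fst q, snd q} = {})"

text \<open>
  The paths are chosen greedily: a shortest path has at most \<open>2 * k\<close> vertices, so the earlier
  paths and the other terminals never use up the robustness.
\<close>

lemma exists_linked:
  assumes "W \<subseteq> V" "finite D" "disjoint_pairs D"
    and conn: "\<And>p. p \<in> D \<Longrightarrow> reach E W (fst p) (snd p)"
    and "robust c W" "card D * (2 * k + 2) \<le> c"
  shows "\<exists>F. linked W D F"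
proof -
  \<comment> \<open>The invariant also keeps the paths away from the terminals of pairs that are
    still to be linked; otherwise such a terminal could lie in the set deleted for its own
    pair.\<close>
  have "\<exists>F. linked W D' F \<and>
      (\<forall>p\<in>D'. length (F p) \<le> 2 * k \<and> (\<forall>q\<in>D. q \<noteq> p \<longrightarrow> fst q \<notin> set (F p) \<and> snd q \<notin> set (F p)))"
    if "D' \<subseteq> D" for D'
    using finite_subset[OF that \<open>finite D\<close>] that
  proof (induction D' rule: finite_induct)
    case empty
    then show ?case by (auto simp: linked_def disjoint_family_on_def)
  next
    case (insert p D')
    then obtain F where F: "linked W D' F"
      and F': "\<forall>p\<in>D'. length (F p) \<le> 2 * k \<and>
        (\<forall>q\<in>D. q \<noteq> p \<longrightarrow> fst q \<notin> set (F p) \<and> snd q \<notin> set (F p))"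
      by blast
    have len: "\<And>q. q \<in> D' \<Longrightarrow> length (F q) \<le> 2 * k"
      and avoid: "\<And>q r. q \<in> D' \<Longrightarrow> r \<in> D \<Longrightarrow> r \<noteq> q \<Longrightarrow> fst r \<notin> set (F q) \<and> snd r \<notin> set (F q)"
      using F' by blast+
    \<comment> \<open>Each pair contributes at most \<open>2 * k\<close> vertices of a path already
      found and 2 terminals, whence the factor \<open>2 * k + 2\<close> in the budget.\<close>
    define B where "B = (\<Union>q\<in>D'. set (F q)) \<union> (\<Union>q\<in>D - {p}. {fst q, snd q})"
    have FW: "set (F q) \<subseteq> W" if "q \<in> D'" for q
      using F that by (auto simp: linked_def path_in_def)
    have "card (\<Union>q\<in>D'. set (F q)) \<le> card D' * (2 * k)"
      by (rule card_UN_le[OF insert.hyps(1), THEN order_trans])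
        (auto intro!: sum_bounded_above[THEN order_trans] order_trans[OF card_length len])
    moreover have "card (\<Union>q\<in>D - {p}. {fst q, snd q}) \<le> (\<Sum>q\<in>D - {p}. card {fst q, snd q})"
      using \<open>finite D\<close> by (intro card_UN_le) simp
    moreover have "(\<Sum>q\<in>D - {p}. card {fst q, snd q}) \<le> (\<Sum>q\<in>D - {p}. 2)"
      by (rule sum_mono) (simp add: card_insert_if)
    moreover have "card D' \<le> card D" "card (D - {p}) \<le> card D"
      using insert.prems \<open>finite D\<close> by (auto intro: card_mono card_Diff1_le)
    ultimately have "card B \<le> card D * (2 * k) + card D * 2"
      unfolding B_def
      by (intro card_Un_le[THEN order_trans] add_mono)
        (auto intro: order_trans mult_le_mono1 simp: card_Diff_subset)
    then have "card B \<le> c" using assms(6) by (simp add: algebra_simps)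
    moreover have "B \<subseteq> V" using FW conn reach_in \<open>W \<subseteq> V\<close> unfolding B_def by fastforce
    moreover have "fst p \<notin> B" "snd p \<notin> B"
      using insert.prems insert.hyps avoid[of _ p] assms(3)
      unfolding B_def disjoint_pairs_def by blast+
    ultimately have "reach E (W - B) (fst p) (snd p)"
      using conn insert.prems \<open>robust c W\<close> unfolding robust_def by blast
    then obtain xs where xs: "path_in E (W - B) (fst p) xs (snd p)" "length xs \<le> 2 * k"
      using reach_short_path \<open>W \<subseteq> V\<close> by blast
    then have xsB: "set xs \<inter> B = {}" "path_in E W (fst p) xs (snd p)"
      by (auto simp: path_in_def)
    define F' where "F' = F(p := xs)"
    have F'_p: "F' p = xs" and F'_q: "F' q = F q" if "q \<in> D'" for q
      using insert.hyps that by (auto simp: F'_def)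
    have "set xs \<inter> (\<Union>q\<in>D'. set (F' q)) = {}"
      using xsB(1) F'_q unfolding B_def by auto
    moreover have "disjoint_family_on (\<lambda>q. set (F' q)) D'"
      using F F'_q unfolding linked_def disjoint_family_on_def by simp
    ultimately have "disjoint_family_on (\<lambda>q. set (F' q)) (insert p D')"
      using insert.hyps by (simp add: disjoint_family_on_insert F'_def)
    moreover have "\<forall>q\<in>insert p D'. path_in E W (fst q) (F' q) (snd q)"
      using F F'_q xsB(2) unfolding linked_def by (simp add: F'_def)
    ultimately have "linked W (insert p D') F'" unfolding linked_def by blast
    moreover have "\<forall>q\<in>insert p D'. length (F' q) \<le> 2 * k \<and>
        (\<forall>r\<in>D. r \<noteq> q \<longrightarrow> fst r \<notin> set (F' q) \<and> snd r \<notin> set (F' q))"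
    proof
      fix q assume q: "q \<in> insert p D'"
      show "length (F' q) \<le> 2 * k \<and>
        (\<forall>r\<in>D. r \<noteq> q \<longrightarrow> fst r \<notin> set (F' q) \<and> snd r \<notin> set (F' q))"
      proof (cases "q = p")
        case True
        have "fst r \<in> B" "snd r \<in> B" if "r \<in> D" "r \<noteq> p" for r
          using that unfolding B_def by blast+
        then show ?thesis using True xs(2) xsB(1) by (auto simp: F'_def)
      next
        case False
        then show ?thesis using q len avoid F'_q by simp
      qed
    qed
    ultimately show ?case by blast
  qed
  from this[of D] show ?thesis by blast
qed


lemma linked_update:
  assumes "linked W D F" "path_in E W (fst p) ys (snd p)"
    and "\<And>q. q \<in> D \<Longrightarrow> q \<noteq> p \<Longrightarrow> set ys \<inter> set (F q) = {}"
  shows "linked W D (F(p := ys))"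
  unfolding linked_def disjoint_family_on_def
proof (intro conjI ballI impI)
  fix q assume "q \<in> D"
  then show "path_in E W (fst q) ((F(p := ys)) q) (snd q)"
    using assms(1,2) by (cases "q = p") (simp_all add: linked_def)
next
  fix q r assume qr: "q \<in> D" "r \<in> D" "q \<noteq> r"
  show "set ((F(p := ys)) q) \<inter> set ((F(p := ys)) r) = {}"
  proof (cases "q = p \<or> r = p")
    case True
    then show ?thesis using qr assms(3)[of q] assms(3)[of r] by auto
  next
    case False
    then show ?thesis using qr assms(1) by (simp add: linked_def disjoint_family_on_def)
  qed
qed

text \<open>
  The Chvatal-Erdos argument, with \<open>H\<close> the component of an uncovered vertex and \<open>N\<close> its neighbours
  on the paths. If \<open>N\<close> is small, robustness forces a whole path of that component into \<open>N\<close>, and a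
  detour through \<open>H\<close> fits between two consecutive vertices. If \<open>N\<close> is large, one path has at least
  \<open>k\<close> vertices with predecessor in \<open>N\<close>; two of them are adjacent, and the path can be rerouted
  through \<open>H\<close>, traversing the part in between backwards.
\<close>

lemma maximal_linked_covers:
  assumes "W \<subseteq> V" "finite D" and F: "linked W D F"
    and maximal: "\<And>F'. linked W D F' \<Longrightarrow> card (\<Union>p\<in>D. set (F' p)) \<le> card (\<Union>p\<in>D. set (F p))"
    and nontrivial: "\<And>p. p \<in> D \<Longrightarrow> fst p \<noteq> snd p"
    and cover: "\<And>z. z \<in> W \<Longrightarrow> \<exists>p\<in>D. reach E W z (fst p)"
    and robust: "robust c W" "card D * k \<le> c"
  shows "(\<Union>p\<in>D. set (F p)) = W"
proof (rule ccontr)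
  define U where "U = (\<Union>p\<in>D. set (F p))"
  have path: "path_in E W (fst p) (F p) (snd p)" if "p \<in> D" for p
    using F that by (auto simp: linked_def)
  have "U \<subseteq> W" using path by (fastforce simp: U_def path_in_def)
  have "finite W" using \<open>W \<subseteq> V\<close> finite_V by (rule finite_subset)
  assume "(\<Union>p\<in>D. set (F p)) \<noteq> W"
  then obtain z where z: "z \<in> W" "z \<notin> U" using \<open>U \<subseteq> W\<close> U_def by blast
  define H where "H = {h. reach E (W - U) z h}"
  define N where "N = {x \<in> U. \<exists>h\<in>H. (h, x) \<in> E}"
  have "N \<subseteq> U" by (auto simp: N_def)
  \<comment> \<open>Both attachment vertices have a neighbour in \<open>H\<close>, and
    \<open>H\<close> is connected by uncovered vertices only.\<close>
  have detour: "\<exists>hs. hs \<noteq> [] \<and> set hs \<subseteq> W - U \<and> distinct hs \<and> chain E hs \<and>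
      (x, hd hs) \<in> E \<and> (last hs, y) \<in> E" if xy: "x \<in> N" "y \<in> N" for x y
  proof -
    obtain h h' where h: "h \<in> H" "(h, x) \<in> E" "h' \<in> H" "(h', y) \<in> E"
      using xy unfolding N_def by blast
    then have "reach E (W - U) h h'"
      unfolding H_def using reach_sym[OF sym_E] reach_trans by (metis mem_Collect_eq)
    then obtain hs where "path_in E (W - U) h hs h'"
      using reach_short_path[of "W - U"] \<open>W \<subseteq> V\<close> by blast
    then show ?thesis using h symD[OF sym_E] unfolding path_in_def by blast
  qed
  \<comment> \<open>The vertices of \<open>hs\<close> are uncovered, so the extended path stays
    disjoint from all others, and the new linkage covers more than a maximal one.\<close>
  have no_extension: False
    if p: "p \<in> D" and ys: "path_in E W (fst p) ys (snd p)" and set_ys: "set ys = set (F p) \<union> set hs"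
      and hs: "hs \<noteq> []" "set hs \<subseteq> W - U" for p ys hs
  proof -
    have "set ys \<inter> set (F q) = {}" if "q \<in> D" "q \<noteq> p" for q
    proof -
      have "set (F p) \<inter> set (F q) = {}"
        using F p that by (simp add: linked_def disjoint_family_on_def)
      moreover have "set (F q) \<subseteq> U" using that by (auto simp: U_def)
      ultimately show ?thesis using set_ys hs by blast
    qed
    then have "linked W D (F(p := ys))" using linked_update[OF F ys] by blast
    then have "card (\<Union>q\<in>D. set ((F(p := ys)) q)) \<le> card U"
      unfolding U_def by (rule maximal)
    moreover have "(\<Union>q\<in>D. set ((F(p := ys)) q)) = U \<union> set hs"
      using p set_ys by (auto simp: U_def split: if_splits)
    moreover have "card U < card (U \<union> set hs)"
    proof (rule psubset_card_mono)
      show "finite (U \<union> set hs)" using \<open>U \<subseteq> W\<close> \<open>finite W\<close> by (auto intro: finite_subset)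
      show "U \<subset> U \<union> set hs" using hs by (cases hs) auto
    qed
    ultimately show False by simp
  qed
  have U_disj: "set (F p) \<inter> set hs = {}" if "p \<in> D" "set hs \<subseteq> W - U" for p hs
    using that by (auto simp: U_def)
  have no_consecutive: False if p: "p \<in> D" and eq: "F p = xs @ x # y # ys" and "x \<in> N" "y \<in> N" for p xs x y ys
  proof -
    obtain hs where hs: "hs \<noteq> []" "set hs \<subseteq> W - U" "distinct hs" "chain E hs"
        "(x, hd hs) \<in> E" "(last hs, y) \<in> E" using detour[OF \<open>x \<in> N\<close> \<open>y \<in> N\<close>] by blast
    let ?ys = "xs @ x # hs @ y # ys"
    have "path_in E W (fst p) ?ys (snd p)"
      using path[OF p] hs U_disj[OF p hs(2)] unfolding eq path_in_def
      by (auto simp: successively_append_iff successively_Cons hd_append)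
    then show False using no_extension[OF p, of ?ys hs] hs eq by auto
  qed
  have no_reroute: False
    if p: "p \<in> D" and eq: "F p = p1 @ p2 @ p3" and ne: "p1 \<noteq> []" "p2 \<noteq> []" "p3 \<noteq> []"
      and N: "last p1 \<in> N" "last p2 \<in> N" and edge: "(hd p2, hd p3) \<in> E" for p p1 p2 p3
  proof -
    obtain hs where hs: "hs \<noteq> []" "set hs \<subseteq> W - U" "distinct hs" "chain E hs"
        "(last p1, hd hs) \<in> E" "(last hs, last p2) \<in> E" using detour[OF N] by blast
    \<comment> \<open>The detour leads from the end of \<open>p1\<close> to the end of
      \<open>p2\<close>; then \<open>p2\<close> is traversed back to its head, from where
      \<open>edge\<close> leads to the head of \<open>p3\<close>.\<close>
    let ?ys = "p1 @ hs @ rev p2 @ p3"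
    have "(\<lambda>u v. (v, u) \<in> E) = (\<lambda>u v. (u, v) \<in> E)" using symD[OF sym_E] by blast
    from arg_cong[OF this, of "\<lambda>P. successively P p2"]
    have "chain E (rev p2) \<longleftrightarrow> chain E p2" by (simp only: successively_rev)
    then have "path_in E W (fst p) ?ys (snd p)"
      using path[OF p] hs ne edge U_disj[OF p hs(2)] unfolding eq path_in_def
      by (auto simp: successively_append_iff hd_append hd_rev last_rev)
    then show False using no_extension[OF p, of ?ys hs] hs eq by auto
  qed
  show False
  proof (cases "card N \<le> c")
    case True
    obtain p where p: "p \<in> D" "reach E W z (fst p)" using cover z by blast
    have "N \<subseteq> V" "z \<notin> N" using \<open>N \<subseteq> U\<close> \<open>U \<subseteq> W\<close> \<open>W \<subseteq> V\<close> z by auto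
    \<comment> \<open>Outside \<open>N\<close>, robustness would yield a walk from \<open>z\<close>
      to \<open>x\<close> avoiding \<open>N\<close>. Such a walk can never leave \<open>H\<close>,
      because its first covered vertex would be a neighbour of \<open>H\<close> and thus belong to
      \<open>N\<close>; but \<open>x\<close> is covered.\<close>
    have in_N: "x \<in> N" if "x \<in> U" "reach E W z x" for x
    proof (rule ccontr)
      assume "x \<notin> N"
      then have "reach E (W - N) z x"
        using robust(1) True \<open>N \<subseteq> V\<close> \<open>z \<notin> N\<close> that unfolding robust_def by blast
      then have "x \<in> H"
      proof (induction rule: reach_induct)
        case refl
        then show ?case using z by (simp add: H_def reach_refl)
      next
        case (step x y)
        then have "y \<notin> U" by (auto simp: N_def)
        moreover have "x \<in> W - U" using step by (auto simp: H_def dest: reach_in)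
        ultimately have "reach E (W - U) x y" using step by (intro reach_edge) auto
        then show ?case using step by (auto simp: H_def intro: reach_trans)
      qed
      then show False using \<open>x \<in> U\<close> by (auto simp: H_def dest: reach_in)
    qed
    obtain x y ys where eq: "F p = x # y # ys"
    proof (cases "F p")
      case (Cons x ys)
      then show ?thesis using path[OF p(1)] nontrivial[OF p(1)] that
        by (cases ys) (auto simp: path_in_def)
    qed (use path[OF p(1)] in \<open>auto simp: path_in_def\<close>)
    have xy: "x = fst p" "(x, y) \<in> E" "y \<in> W" "x \<in> W"
      using path[OF p(1)] by (auto simp: eq path_in_def)
    then have "reach E W z y" using p(2) reach_edge reach_trans by metis
    moreover have "x \<in> U" "y \<in> U" using p(1) eq by (auto simp: U_def intro!: bexI[of _ p])
    ultimately show False using no_consecutive[OF p(1), of "[]" x y ys] eq in_N xy p(2) by auto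
  next
    case False
    \<comment> \<open>Pigeonhole, as \<open>card N\<close> exceeds \<open>card D * k\<close>. More
      than \<open>k\<close> vertices are wanted because the last vertex of the path has no
      successor; at least \<open>k\<close> successors then remain.\<close>
    have "\<exists>p\<in>D. k < card (N \<inter> set (F p))"
    proof (rule ccontr)
      assume *: "\<not> ?thesis"
      have "N = (\<Union>p\<in>D. N \<inter> set (F p))" using \<open>N \<subseteq> U\<close> by (auto simp: U_def)
      then have "card N \<le> (\<Sum>p\<in>D. card (N \<inter> set (F p)))"
        using card_UN_le[OF \<open>finite D\<close>] by metis
      also have "\<dots> \<le> card D * k"
        using * sum_bounded_above[of D "\<lambda>p. card (N \<inter> set (F p))" k] by (simp add: not_less)
      finally show False using False robust(2) by simp
    qed
    then obtain p where p: "p \<in> D" "k < card (N \<inter> set (F p))" by blast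
    define xs where "xs = F p"
    have dist: "distinct xs" "set xs \<subseteq> W" "xs \<noteq> []"
      using path[OF p(1)] by (auto simp: xs_def path_in_def)
    define J where "J = {j. Suc j < length xs \<and> xs ! j \<in> N}"
    have "finite J" by (rule finite_subset[of _ "{..<length xs}"]) (auto simp: J_def)
    have "N \<inter> set xs \<subseteq> insert (last xs) ((!) xs ` J)"
    proof
      fix x assume "x \<in> N \<inter> set xs"
      then obtain j where j: "j < length xs" "xs ! j = x" "x \<in> N" by (auto simp: in_set_conv_nth)
      show "x \<in> insert (last xs) ((!) xs ` J)"
      proof (cases "Suc j < length xs")
        case False
        then have "j = length xs - 1" using j by linarith
        then show ?thesis using j dist(3) by (simp add: last_conv_nth)
      qed (use j in \<open>auto simp: J_def\<close>)
    qed
    then have "card (N \<inter> set xs) \<le> card (insert (last xs) ((!) xs ` J))"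
      using \<open>finite J\<close> by (intro card_mono) auto
    also have "\<dots> \<le> Suc (card ((!) xs ` J))"
      using \<open>finite J\<close> by (simp add: card_insert_if)
    also have "\<dots> \<le> Suc (card J)"
      using \<open>finite J\<close> by (simp add: card_image_le)
    finally have "k \<le> card J" using p(2) by (simp add: xs_def)
    let ?S = "(\<lambda>j. xs ! Suc j) ` J"
    have "card ?S = card J"
      using dist by (intro card_image) (auto simp: inj_on_def J_def nth_eq_iff_index_eq)
    then have "\<not> card ?S < k" using \<open>k \<le> card J\<close> by simp
    moreover have "?S \<subseteq> V"
      by (auto simp: J_def intro!: subsetD[OF \<open>W \<subseteq> V\<close>] subsetD[OF dist(2)] nth_mem)
    ultimately have "\<exists>u\<in>?S. \<exists>v\<in>?S. (u, v) \<in> E" using independent_card[of ?S] by blast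
    then obtain i j where ij: "i \<in> J" "j \<in> J" "(xs ! Suc i, xs ! Suc j) \<in> E" by blast
    then have "i \<noteq> j" using irrefl_E by auto
    then obtain i j where ij: "i \<in> J" "j \<in> J" "(xs ! Suc i, xs ! Suc j) \<in> E" "i < j"
      using ij sym_E by (metis nat_neq_iff symD)
    let ?p1 = "take (Suc i) xs" and ?p2 = "drop (Suc i) (take (Suc j) xs)" and ?p3 = "drop (Suc j) xs"
    have len: "Suc i < length xs" "Suc j < length xs" and N: "xs ! i \<in> N" "xs ! j \<in> N"
      using ij by (auto simp: J_def)
    have "take (Suc j) xs = ?p1 @ ?p2"
      using ij(4) by (metis append_take_drop_id less_imp_le_nat min.absorb1 Suc_le_mono take_take)
    then have eq: "F p = ?p1 @ ?p2 @ ?p3" unfolding xs_def by (metis append_assoc append_take_drop_id)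
    have ne: "?p1 \<noteq> []" "?p2 \<noteq> []" "?p3 \<noteq> []" using len ij(4) dist(3) by auto
    have "last ?p1 = xs ! i" "last ?p2 = xs ! j"
      using len ij(4) by (simp_all add: take_Suc_conv_app_nth)
    moreover have "hd ?p2 = xs ! Suc i" "hd ?p3 = xs ! Suc j"
      using len ij(4) by (simp_all add: hd_drop_conv_nth)
    ultimately have "last ?p1 \<in> N" "last ?p2 \<in> N" "(hd ?p2, hd ?p3) \<in> E"
      using N ij(3) by metis+
    then show False by (rule no_reroute[OF p(1) eq ne])
  qed
qed

text \<open>The greedy linkage shows that there is some linkage, and the number of covered vertices
  is at most \<open>card W\<close>, so one of them is maximal. The budget of the greedy step also
  pays for the \<open>card D * k\<close> of the maximality argument.\<close>

lemma exists_linked_cover: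
  assumes "W \<subseteq> V" "finite D" "disjoint_pairs D"
    and nontrivial: "\<And>p. p \<in> D \<Longrightarrow> fst p \<noteq> snd p"
    and conn: "\<And>p. p \<in> D \<Longrightarrow> reach E W (fst p) (snd p)"
    and cover: "\<And>z. z \<in> W \<Longrightarrow> \<exists>p\<in>D. reach E W z (fst p)"
    and robust: "robust c W" "card D * (2 * k + 2) \<le> c"
  shows "\<exists>F. linked W D F \<and> (\<Union>p\<in>D. set (F p)) = W"
proof -
  let ?f = "\<lambda>F. card (\<Union>p\<in>D. set (F p))"
  have bound: "?f F \<le> card W" if "linked W D F" for F
    using that \<open>W \<subseteq> V\<close> finite_V
    by (intro card_mono) (auto intro: finite_subset simp: linked_def path_in_def)
  obtain F\<^sub>0 where F\<^sub>0: "linked W D F\<^sub>0"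
    using exists_linked[OF assms(1-3) conn robust] by blast
  have "\<exists>F. linked W D F \<and> (\<forall>F'. linked W D F' \<longrightarrow> ?f F' \<le> ?f F)"
    using bound F\<^sub>0
    by (intro ex_has_greatest_nat[where P = "linked W D" and f = ?f and k = F\<^sub>0 and b = "Suc (card W)"])
      (simp_all add: less_Suc_eq_le)
  then obtain F where F: "linked W D F" and max: "\<And>F'. linked W D F' \<Longrightarrow> ?f F' \<le> ?f F"
    by blast
  have "card D * k \<le> card D * (2 * k + 2)" by (rule mult_le_mono2) simp
  then have "card D * k \<le> c" using robust(2) by simp
  then show ?thesis
    using maximal_linked_covers[OF assms(1,2) F max nontrivial cover robust(1)] F by blast
qed

subsection \<open>Cuts and skeletons\<close>


text \<open>
  Take \<open>j\<close> maximal such that deleting at most \<open>M j\<close> vertices leaves \<open>j\<close> vertices in pairwise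
  different components. A failure of robustness would split one more component.
\<close>

lemma exists_robust_cut:
  assumes M: "\<And>j. M j + c j \<le> M (Suc j)"
  shows "\<exists>j<k. \<exists>A\<subseteq>V. card A \<le> M j \<and> robust (c j) (V - A)"
proof -
  \<comment> \<open>\<open>R\<close> consists of representatives of different components of
    \<open>V - A\<close>. Adjacent vertices lie in one component, so \<open>R\<close> is independent
    and has fewer than \<open>k\<close> elements.\<close>
  define sep where "sep A R \<longleftrightarrow> A \<subseteq> V \<and> R \<subseteq> V - A \<and>
    (\<forall>u\<in>R. \<forall>v\<in>R. u \<noteq> v \<longrightarrow> \<not> reach E (V - A) u v)" for A R
  define P where "P j \<longleftrightarrow> (\<exists>A R. sep A R \<and> card A \<le> M j \<and> j \<le> card R)" for j
  have less_k: "j < k" if "P j" for j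
  proof -
    obtain A R where AR: "sep A R" "j \<le> card R" using \<open>P j\<close> by (auto simp: P_def)
    have "(u, v) \<notin> E" if "u \<in> R" "v \<in> R" for u v
    proof
      assume e: "(u, v) \<in> E"
      have "u \<in> V - A" "v \<in> V - A" using AR(1) that unfolding sep_def by blast+
      with e have "reach E (V - A) u v" by (rule reach_edge)
      moreover have "u \<noteq> v" using e irrefl_E by blast
      ultimately show False using AR(1) that unfolding sep_def by blast
    qed
    moreover have "R \<subseteq> V" using AR(1) unfolding sep_def by blast
    ultimately show ?thesis using independent_card AR(2) by (meson le_less_trans)
  qed
  have "P 0" unfolding P_def sep_def by (intro exI[of _ "{}"]) simp
  then obtain j where j: "P j" and max: "\<And>i. P i \<Longrightarrow> i \<le> j"
    using Nat.ex_has_greatest_nat[of P 0 k] less_k by (metis less_imp_le)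
  obtain A R where AR: "sep A R" "card A \<le> M j" "j \<le> card R" using j by (auto simp: P_def)
  have sepR: "u = v" if "u \<in> R" "v \<in> R" "reach E (V - A) u v" for u v
    using AR(1) that unfolding sep_def by metis
  have fin: "finite A" "finite R"
    using AR(1) finite_V unfolding sep_def by (meson finite_subset finite_Diff)+
  have "robust (c j) (V - A)"
    unfolding robust_def
  proof (intro allI impI, rule ccontr)
    fix B u v
    assume B: "card B \<le> c j" "B \<subseteq> V" "u \<notin> B" "v \<notin> B" and uv: "reach E (V - A) u v"
      and not: "\<not> reach E (V - A - B) u v"
    \<comment> \<open>Only the part of \<open>B\<close> in the component of \<open>u\<close> is
      deleted, so that representatives of other components survive. A walk from \<open>u\<close>
      stays in that component, hence avoiding \<open>B'\<close> is the same as avoiding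
      \<open>B\<close> for it.\<close>
    define B' where "B' = {w \<in> B. reach E (V - A) u w}"
    have not': "\<not> reach E (V - (A \<union> B')) u v"
    proof
      assume "reach E (V - (A \<union> B')) u v"
      then have "reach E (V - A - B) u v"
      proof (induction rule: reach_induct)
        case refl
        then show ?case using reach_in[OF uv] B by (auto intro: reach_refl)
      next
        case (step x y)
        have "reach E (V - A) u x" using step.IH by (rule reach_mono) auto
        moreover have x: "x \<in> V - A - B" using reach_in(2)[OF step.IH] .
        moreover have "reach E (V - A) x y" using step x by (intro reach_edge) auto
        ultimately have "reach E (V - A) u y" by (blast intro: reach_trans)
        then have "y \<in> V - A - B" using step.hyps(2) by (auto simp: B'_def)
        then have "reach E (V - A - B) x y" using step.hyps(3) x by (intro reach_edge)
        then show ?case using step.IH by (blast intro: reach_trans)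
      qed
      then show False using not by contradiction
    qed
    \<comment> \<open>The component of \<open>u\<close> and \<open>v\<close> contains at most one
      representative. It is dropped and replaced by the two vertices \<open>u\<close> and
      \<open>v\<close>, which is a net gain of at least one.\<close>
    define Q where "Q = {r \<in> R. \<not> reach E (V - A) u r}"
    define R' where "R' = insert u (insert v Q)"
    have uv': "u \<noteq> v" "u \<notin> Q" "v \<notin> Q" "u \<in> V - A" "v \<in> V - A" "u \<notin> B'" "v \<notin> B'"
      using not' uv reach_in[OF uv] B by (auto simp: Q_def B'_def reach_refl)
    have mono: "reach E (V - A) x y" if "reach E (V - (A \<union> B')) x y" for x y
      using that by (rule reach_mono) auto
    have symr: "reach E (V - A) y x" if "reach E (V - A) x y" for x y
      using that by (rule reach_sym[OF sym_E])
    have Q_uv: "\<not> reach E (V - A) u r" "\<not> reach E (V - A) v r" "\<not> reach E (V - A) r u"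
        "\<not> reach E (V - A) r v" if "r \<in> Q" for r
    proof -
      show 1: "\<not> reach E (V - A) u r" using that by (simp add: Q_def)
      then show 2: "\<not> reach E (V - A) v r" using uv reach_trans[of E "V - A" u v r] by blast
      show "\<not> reach E (V - A) r u" using 1 symr[of r u] by blast
      show "\<not> reach E (V - A) r v" using 2 symr[of r v] by blast
    qed
    have "sep (A \<union> B') R'"
      unfolding sep_def
    proof (intro conjI ballI impI)
      show "A \<union> B' \<subseteq> V" using AR(1) B by (auto simp: sep_def B'_def)
      have "Q \<subseteq> V - (A \<union> B')" using AR(1) by (auto simp: sep_def Q_def B'_def)
      then show "R' \<subseteq> V - (A \<union> B')" using uv' by (auto simp: R'_def)
      fix x y assume xy: "x \<in> R'" "y \<in> R'" "x \<noteq> y"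
      show "\<not> reach E (V - (A \<union> B')) x y"
      proof (cases "x \<in> Q")
        case True
        show ?thesis
        proof (cases "y \<in> Q")
          case y: True
          have "\<not> reach E (V - A) x y" using sepR[of x y] True y xy(3) by (auto simp: Q_def)
          then show ?thesis using mono by blast
        next
          case False
          then show ?thesis using True xy Q_uv mono unfolding R'_def by blast
        qed
      next
        case False
        show ?thesis
        proof (cases "y \<in> Q")
          case True
          then show ?thesis using False xy Q_uv mono unfolding R'_def by blast
        next
          case y: False
          then have "x = u \<and> y = v \<or> x = v \<and> y = u" using False xy unfolding R'_def by blast
          then show ?thesis using not' reach_sym[OF sym_E] by blast
        qed
      qed
    qed
    moreover have "card (A \<union> B') \<le> M (Suc j)"
    proof -
      have "finite B" using B(2) finite_V by (rule finite_subset)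
      then have "card B' \<le> c j" using B(1) card_mono[of B B'] by (auto simp: B'_def)
      then show ?thesis using AR(2) M[of j] card_Un_le[of A B'] by linarith
    qed
    moreover have "Suc j \<le> card R'"
    proof -
      have "R - Q \<subseteq> {r}" if "r \<in> R - Q" for r
      proof
        fix r' assume r': "r' \<in> R - Q"
        then have "reach E (V - A) r r'" 
          using that symr[of u r] reach_trans[of E "V - A" r u r'] unfolding Q_def by blast
        then show "r' \<in> {r}" using sepR[of r r'] that r' by simp
      qed
      then have "\<exists>r. R - Q \<subseteq> {r}" by blast
      then obtain r where "R - Q \<subseteq> {r}" by blast
      then have "card (R - Q) \<le> 1" using card_mono[of "{r}" "R - Q"] by simp
      moreover have "card R \<le> card Q + card (R - Q)"
      proof -
        have "R = Q \<union> (R - Q)" by (auto simp: Q_def)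
        then show ?thesis by (metis card_Un_le)
      qed
      moreover have "card R' = Suc (Suc (card Q))"
        using uv' fin by (simp add: R'_def Q_def)
      ultimately show ?thesis using AR(3) by linarith
    qed
    ultimately have "P (Suc j)" unfolding P_def by blast
    then show False using max by fastforce
  qed
  then show ?thesis using AR less_k[OF j] unfolding sep_def by blast
qed

text \<open>
  A skeleton records, for each path of a linkage, the first and last vertices of its maximal
  segments outside \<open>A\<close>; single vertices (in particular those of \<open>A\<close>) appear as pairs \<open>(a, a)\<close>.
\<close>

definition skeleton :: "'a set \<Rightarrow> 'a list \<Rightarrow> 'a list \<Rightarrow> nat \<Rightarrow> (nat \<Rightarrow> ('a \<times> 'a) list) \<Rightarrow> bool" where
  "skeleton A ss ts l sk \<longleftrightarrow>
     (\<forall>i<l. sk i \<noteq> [] \<and> fst (hd (sk i)) = ss ! i \<and> snd (last (sk i)) = ts ! i \<and>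
        successively (\<lambda>p q. (snd p, fst q) \<in> E) (sk i)) \<and>
     (\<forall>i<l. \<forall>p\<in>set (sk i). fst p \<in> V \<and> (fst p = snd p \<or> reach E (V - A) (fst p) (snd p))) \<and>
     (\<forall>i<l. \<forall>j<l. \<forall>a<length (sk i). \<forall>b<length (sk j). (i, a) \<noteq> (j, b) \<longrightarrow>
        {fst (sk i ! a), snd (sk i ! a)} \<inter> {fst (sk j ! b), snd (sk j ! b)} = {}) \<and>
     (\<forall>z\<in>V. \<exists>i<l. \<exists>p\<in>set (sk i).
        fst p = z \<and> snd p = z \<or> fst p \<noteq> snd p \<and> reach E (V - A) z (fst p))"

definition hamiltonian_paths :: "'a list \<Rightarrow> 'a list \<Rightarrow> nat \<Rightarrow> (nat \<Rightarrow> 'a list) \<Rightarrow> bool" where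
  "hamiltonian_paths ss ts l P \<longleftrightarrow> (\<forall>i<l. path_in E V (ss ! i) (P i) (ts ! i)) \<and>
     disjoint_family_on (\<lambda>i. set (P i)) {..<l} \<and> (\<Union>i<l. set (P i)) = V"

section \<open>Skeletons of bounded length characterise Hamiltonian linkages\<close>

lemma path_in_concat:
  assumes "xs \<noteq> []" "distinct xs"
    and "\<And>p. p \<in> set xs \<Longrightarrow> path_in E V (fst p) (F p) (snd p)"
    and "\<And>p q. p \<in> set xs \<Longrightarrow> q \<in> set xs \<Longrightarrow> p \<noteq> q \<Longrightarrow> set (F p) \<inter> set (F q) = {}"
    and "successively (\<lambda>p q. (snd p, fst q) \<in> E) xs"
  shows "path_in E V (fst (hd xs)) (concat (map F xs)) (snd (last xs))"
  using assms
proof (induction xs rule: list_nonempty_induct)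
  case (single p)
  then show ?case by simp
next
  case (cons p xs)
  have IH: "path_in E V (fst (hd xs)) (concat (map F xs)) (snd (last xs))"
    using cons.prems cons.hyps by (intro cons.IH) (auto simp: successively_Cons)
  have p: "path_in E V (fst p) (F p) (snd p)" using cons.prems by simp
  have "(snd p, fst (hd xs)) \<in> E" using cons.prems cons.hyps by (simp add: successively_Cons)
  moreover have "set (F p) \<inter> set (concat (map F xs)) = {}"
  proof -
    have "set (F p) \<inter> set (F q) = {}" if "q \<in> set xs" for q
      using cons.prems(1) cons.prems(3)[of p q] that by auto
    then show ?thesis by auto
  qed
  ultimately show ?case
    using IH p cons.hyps unfolding path_in_def by (simp add: successively_append_iff)
qed

text \<open>The single vertices \<open>T\<close> are removed, the proper pairs \<open>D\<close> are
  linked by disjoint paths covering the rest \<open>W\<close>, and the pieces are concatenated along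
  the skeleton. The factor \<open>2 * k + 3\<close> is the \<open>2 * k + 2\<close> of
  \<open>exists_linked_cover\<close> plus one for deleting \<open>T\<close>, as \<open>D\<close> and
  \<open>T\<close> have at most \<open>l * N\<close> elements each.\<close>

lemma skeleton_sound:
  assumes sk: "skeleton A ss ts l sk" and A: "A \<subseteq> V" and robust: "robust c (V - A)"
    and N: "\<And>i. i < l \<Longrightarrow> length (sk i) \<le> N" and c: "l * N * (2 * k + 3) \<le> c"
  shows "\<exists>P. hamiltonian_paths ss ts l P"
proof -
  define S where "S = (\<Union>i<l. set (sk i))"
  define T where "T = fst ` {p \<in> S. fst p = snd p}"
  define D where "D = {p \<in> S. fst p \<noteq> snd p}"
  define W where "W = V - T"
  have "finite S" by (simp add: S_def)
  have "card S \<le> (\<Sum>i<l. card (set (sk i)))" unfolding S_def by (intro card_UN_le) simp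
  also have "\<dots> \<le> (\<Sum>i<l. N)" using N by (intro sum_mono order_trans[OF card_length]) simp
  finally have card_S: "card S \<le> l * N" by simp
  have "card T \<le> card {p \<in> S. fst p = snd p}"
    unfolding T_def using \<open>finite S\<close> by (intro card_image_le) auto
  also have "\<dots> \<le> card S" using \<open>finite S\<close> by (intro card_mono) auto
  finally have card_T: "card T \<le> l * N" using card_S by simp
  have "card D \<le> card S" using \<open>finite S\<close> unfolding D_def by (intro card_mono) auto
  then have card_D: "card D \<le> l * N" using card_S by simp
  have S_V: "fst p \<in> V" "fst p = snd p \<or> reach E (V - A) (fst p) (snd p)" if "p \<in> S" for p
    using sk that unfolding skeleton_def S_def by blast+
  have index_disj: "{fst (sk i ! a), snd (sk i ! a)} \<inter> {fst (sk j ! b), snd (sk j ! b)} = {}"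
    if "i < l" "j < l" "a < length (sk i)" "b < length (sk j)" "(i, a) \<noteq> (j, b)" for i j a b
    using sk that unfolding skeleton_def by blast
  have "disjoint_pairs S"
    unfolding disjoint_pairs_def
  proof (intro ballI impI)
    fix p q assume "p \<in> S" "q \<in> S" "p \<noteq> q"
    then obtain i j a b where *: "i < l" "j < l" "a < length (sk i)" "b < length (sk j)"
        "p = sk i ! a" "q = sk j ! b" unfolding S_def by (auto simp: in_set_conv_nth)
    moreover have "(i, a) \<noteq> (j, b)" using * \<open>p \<noteq> q\<close> by auto
    ultimately show "{fst p, snd p} \<inter> {fst q, snd q} = {}" using index_disj by simp
  qed
  have sk_disj: "set (sk i) \<inter> set (sk j) = {}" if "i < l" "j < l" "i \<noteq> j" for i j
  proof (rule ccontr)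
    assume "\<not> ?thesis"
    then obtain p where "p \<in> set (sk i)" "p \<in> set (sk j)" by blast
    then obtain a b where "a < length (sk i)" "b < length (sk j)" "sk i ! a = p" "sk j ! b = p"
      by (auto simp: in_set_conv_nth)
    then show False using index_disj[of i j a b] that by simp
  qed
  have sk_distinct: "distinct (sk i)" if "i < l" for i
    unfolding distinct_conv_nth using index_disj[of i i] that by fastforce
  have D_T: "fst p \<notin> T" "snd p \<notin> T" if "p \<in> D" for p
  proof -
    have *: "fst q \<notin> {fst p, snd p}" if "q \<in> S" "fst q = snd q" for q
    proof -
      have "p \<in> S" "p \<noteq> q" using \<open>p \<in> D\<close> that by (auto simp: D_def)
      then show ?thesis using \<open>disjoint_pairs S\<close> that unfolding disjoint_pairs_def by blast
    qed
    have "x \<notin> {fst p, snd p}" if x: "x \<in> T" for x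
    proof -
      obtain q where "q \<in> S" "fst q = snd q" "x = fst q" using x by (auto simp: T_def)
      then show ?thesis using * by simp
    qed
    then show "fst p \<notin> T" "snd p \<notin> T" by auto
  qed
  have cover: "z \<in> T \<or> (\<exists>p\<in>D. reach E (V - A) z (fst p))" if z: "z \<in> V" for z
  proof -
    obtain i p where ip: "i < l" "p \<in> set (sk i)"
        "fst p = z \<and> snd p = z \<or> fst p \<noteq> snd p \<and> reach E (V - A) z (fst p)"
      using sk z unfolding skeleton_def by blast
    then have "p \<in> S" by (auto simp: S_def)
    then show ?thesis using ip(3) unfolding T_def D_def by force
  qed
  \<comment> \<open>A vertex of \<open>A\<close> is unreachable inside \<open>V - A\<close>, so the
    covering clause can only hold for it through a trivial pair.\<close>
  have "A \<subseteq> T" using cover A by (blast dest: reach_in)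
  then have W_eq: "W = V - A - T" by (auto simp: W_def)
  have "T \<subseteq> V" using S_V by (auto simp: T_def)
  have "l * N * (2 * k + 2) + card T \<le> c" using c card_T by (simp add: algebra_simps)
  then have rob: "robust (l * N * (2 * k + 2)) W"
    unfolding W_eq using robust_diff[OF _ \<open>T \<subseteq> V\<close>] robust_anti[OF robust] by blast
  \<comment> \<open>Robustness of \<open>V - A\<close> also guarantees that deleting
    \<open>T\<close> separates neither the ends of a proper pair nor a remaining vertex from the
    pair that covers its component.\<close>
  have "card T \<le> c" using \<open>l * N * (2 * k + 2) + card T \<le> c\<close> by simp
  then have to_W: "reach E W x y" if "reach E (V - A) x y" "x \<notin> T" "y \<notin> T" for x y
    using robust that \<open>T \<subseteq> V\<close> unfolding robust_def W_eq by blast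
  have "\<exists>F. linked W D F \<and> (\<Union>p\<in>D. set (F p)) = W"
  proof (rule exists_linked_cover)
    show "W \<subseteq> V" by (auto simp: W_def)
    show "finite D" using \<open>finite S\<close> by (simp add: D_def)
    show "disjoint_pairs D"
      using \<open>disjoint_pairs S\<close> unfolding disjoint_pairs_def D_def by blast
    show "fst p \<noteq> snd p" if "p \<in> D" for p using that by (simp add: D_def)
    show "reach E W (fst p) (snd p)" if "p \<in> D" for p
      using to_W D_T[OF that] S_V(2)[of p] that by (auto simp: D_def)
    show "\<exists>p\<in>D. reach E W z (fst p)" if "z \<in> W" for z
    proof -
      have "z \<in> V" "z \<notin> T" using that by (auto simp: W_def)
      then obtain p where "p \<in> D" "reach E (V - A) z (fst p)" using cover by blast
      then show ?thesis using to_W D_T(1) \<open>z \<notin> T\<close> by blast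
    qed
    show "robust (l * N * (2 * k + 2)) W" by (fact rob)
    show "card D * (2 * k + 2) \<le> l * N * (2 * k + 2)" using card_D by (rule mult_le_mono1)
  qed
  then obtain F where F: "linked W D F" "(\<Union>p\<in>D. set (F p)) = W" by blast
  define F' where "F' p = (if fst p = snd p then [fst p] else F p)" for p
  have path: "path_in E V (fst p) (F' p) (snd p)" if "p \<in> S" for p
  proof (cases "fst p = snd p")
    case True
    then show ?thesis using S_V(1)[OF that] by (simp add: F'_def path_in_def)
  next
    case False
    then have "p \<in> D" using that by (simp add: D_def)
    then have "path_in E W (fst p) (F p) (snd p)" using F(1) unfolding linked_def by blast
    moreover have "W \<subseteq> V" by (auto simp: W_def)
    ultimately show ?thesis using False unfolding path_in_def by (auto simp: F'_def)
  qed
  have F'_W: "set (F' p) \<subseteq> W" if "p \<in> D" for p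
    using F that by (auto simp: F'_def D_def)
  have F'_T: "set (F' p) \<subseteq> T" if "p \<in> S" "p \<notin> D" for p
    using that by (auto simp: F'_def D_def T_def)
  have "W \<inter> T = {}" by (auto simp: W_def)
  have disj: "set (F' p) \<inter> set (F' q) = {}" if pq: "p \<in> S" "q \<in> S" "p \<noteq> q" for p q
  proof (cases "p \<in> D"; cases "q \<in> D")
    assume "p \<in> D" "q \<in> D"
    then have "set (F p) \<inter> set (F q) = {}"
      using F(1) pq(3) unfolding linked_def disjoint_family_on_def by blast
    then show ?thesis using \<open>p \<in> D\<close> \<open>q \<in> D\<close> by (simp add: F'_def D_def)
  next
    assume "p \<notin> D" "q \<notin> D"
    then show ?thesis using pq \<open>disjoint_pairs S\<close> by (auto simp: D_def F'_def disjoint_pairs_def)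
  qed (use F'_W F'_T pq \<open>W \<inter> T = {}\<close> in blast)+
  have union: "(\<Union>p\<in>S. set (F' p)) = V"
  proof
    show "(\<Union>p\<in>S. set (F' p)) \<subseteq> V" using path by (auto simp: path_in_def)
    have "T \<subseteq> (\<Union>p\<in>S. set (F' p))" by (auto simp: T_def F'_def)
    moreover have "W \<subseteq> (\<Union>p\<in>S. set (F' p))"
      unfolding F(2)[symmetric] by (auto simp: D_def F'_def)
    ultimately show "V \<subseteq> (\<Union>p\<in>S. set (F' p))" by (auto simp: W_def)
  qed
  have "hamiltonian_paths ss ts l (\<lambda>i. concat (map F' (sk i)))"
    unfolding hamiltonian_paths_def
  proof (intro conjI allI impI)
    fix i assume i: "i < l"
    then have sub: "set (sk i) \<subseteq> S" by (auto simp: S_def)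
    have *: "sk i \<noteq> []" "fst (hd (sk i)) = ss ! i" "snd (last (sk i)) = ts ! i"
      "successively (\<lambda>p q. (snd p, fst q) \<in> E) (sk i)"
      using sk i unfolding skeleton_def by blast+
    have "path_in E V (fst (hd (sk i))) (concat (map F' (sk i))) (snd (last (sk i)))"
      using *(1) sk_distinct[OF i] path[OF subsetD[OF sub]] disj[OF subsetD[OF sub] subsetD[OF sub]] *(4)
      by (rule path_in_concat)
    then show "path_in E V (ss ! i) (concat (map F' (sk i))) (ts ! i)" using *(2,3) by simp
  next
    have "set (concat (map F' (sk i))) \<inter> set (concat (map F' (sk j))) = {}"
      if "i < l" "j < l" "i \<noteq> j" for i j
    proof -
      have "set (F' p) \<inter> set (F' q) = {}" if "p \<in> set (sk i)" "q \<in> set (sk j)" for p q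
        using disj[of p q] sk_disj[of i j] that \<open>i < l\<close> \<open>j < l\<close> \<open>i \<noteq> j\<close> by (auto simp: S_def)
      then show ?thesis unfolding set_concat set_map by blast
    qed
    then show "disjoint_family_on (\<lambda>i. set (concat (map F' (sk i)))) {..<l}"
      by (auto simp: disjoint_family_on_def)
    show "(\<Union>i<l. set (concat (map F' (sk i)))) = V"
      using union by (auto simp: S_def)
  qed
  then show ?thesis by blast
qed

text \<open>Each element of \<open>A\<close> accounts for its own piece and for at most one piece
  following it; the final 1 is for an initial piece outside \<open>A\<close>. The extra summand for
  \<open>hd xs \<in> A\<close> strengthens the induction: it pays for the piece opened when a vertex
  outside \<open>A\<close> is put in front of one in \<open>A\<close>.\<close>

lemma split_at_set:
  assumes "xs \<noteq> []"
  shows "\<exists>rs. concat rs = xs \<and> [] \<notin> set rs \<and>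
    (\<forall>r\<in>set rs. (\<exists>a\<in>A. r = [a]) \<or> set r \<inter> A = {}) \<and>
    length rs + (if hd xs \<in> A then 1 else 0) \<le> 2 * length (filter (\<lambda>x. x \<in> A) xs) + 1"
  using assms
proof (induction xs rule: list_nonempty_induct)
  case (single x)
  then show ?case by (intro exI[of _ "[[x]]"]) auto
next
  case (cons x xs)
  then obtain rs where rs: "concat rs = xs" "[] \<notin> set rs"
    "\<forall>r\<in>set rs. (\<exists>a\<in>A. r = [a]) \<or> set r \<inter> A = {}"
    "length rs + (if hd xs \<in> A then 1 else 0) \<le> 2 * length (filter (\<lambda>x. x \<in> A) xs) + 1"
    by blast
  show ?case
  proof (cases "x \<notin> A \<and> hd xs \<notin> A")
    case True
    \<comment> \<open>Here \<open>x\<close> joins the first piece, which avoids \<open>A\<close>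
      because its head does.\<close>
    obtain r rs' where r: "rs = r # rs'" using rs(1) cons.hyps by (cases rs) auto
    then have "hd r = hd xs" using rs(1,2) by (cases r) auto
    then have "set r \<inter> A = {}" using True rs(3) r by auto
    then show ?thesis
      using True rs r by (intro exI[of _ "(x # r) # rs'"]) auto
  next
    case False
    then show ?thesis using rs by (intro exI[of _ "[x] # rs"]) (auto split: if_splits)
  qed
qed

lemma chain_concat:
  assumes "chain E (concat rs)" "[] \<notin> set rs"
  shows "(\<forall>r\<in>set rs. chain E r) \<and> successively (\<lambda>r q. (last r, hd q) \<in> E) rs"
  using assms
proof (induction rs)
  case (Cons r rs)
  show ?case
  proof (cases "rs = []")
    case True
    then show ?thesis using Cons.prems by simp
  next
    case False
    have "hd rs \<in> set rs" using False by simp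
    then have "hd rs \<noteq> []" using Cons.prems(2) by auto
    with False have hd: "hd (concat rs) = hd (hd rs)" by (rule hd_concat)
    have "concat rs \<noteq> []" using \<open>hd rs \<noteq> []\<close> \<open>hd rs \<in> set rs\<close> by auto
    moreover have "r \<noteq> []" using Cons.prems(2) by auto
    ultimately have "chain E r" "chain E (concat rs)" "(last r, hd (hd rs)) \<in> E"
      using Cons.prems(1) hd by (auto simp: successively_append_iff)
    then show ?thesis using Cons.IH Cons.prems(2) False by (simp add: successively_Cons)
  qed
qed simp

text \<open>Every path is cut at its vertices in \<open>A\<close>, and each piece is recorded by its
  two ends. A piece with two different ends avoids \<open>A\<close>, so it runs inside one component
  of \<open>V - A\<close>.\<close>

lemma skeleton_complete:
  assumes P: "hamiltonian_paths ss ts l P" and A: "A \<subseteq> V"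
  shows "\<exists>sk. skeleton A ss ts l sk \<and> (\<forall>i<l. length (sk i) \<le> 2 * card A + 1)"
proof -
  have path: "path_in E V (ss ! i) (P i) (ts ! i)" if "i < l" for i
    using P that by (simp add: hamiltonian_paths_def)
  have "\<exists>rs. concat rs = P i \<and> [] \<notin> set rs \<and>
    (\<forall>r\<in>set rs. (\<exists>a\<in>A. r = [a]) \<or> set r \<inter> A = {}) \<and> length rs \<le> 2 * card A + 1" if i: "i < l" for i
  proof -
    have "P i \<noteq> []" "distinct (P i)" using path[OF i] by (auto simp: path_in_def)
    have "length (filter (\<lambda>x. x \<in> A) (P i)) = card (set (filter (\<lambda>x. x \<in> A) (P i)))"
      using \<open>distinct (P i)\<close> by (intro distinct_card[symmetric] distinct_filter)
    also have "\<dots> \<le> card A" using A finite_V by (intro card_mono) (auto intro: finite_subset)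
    finally have "length (filter (\<lambda>x. x \<in> A) (P i)) \<le> card A" .
    moreover obtain rs where "concat rs = P i" "[] \<notin> set rs"
      "\<forall>r\<in>set rs. (\<exists>a\<in>A. r = [a]) \<or> set r \<inter> A = {}"
      "length rs + (if hd (P i) \<in> A then 1 else 0) \<le> 2 * length (filter (\<lambda>x. x \<in> A) (P i)) + 1"
      using split_at_set[OF \<open>P i \<noteq> []\<close>, of A] by blast
    ultimately show ?thesis by (intro exI[of _ rs]) auto
  qed
  then obtain rs where rs: "\<And>i. i < l \<Longrightarrow> concat (rs i) = P i" "\<And>i. i < l \<Longrightarrow> [] \<notin> set (rs i)"
    "\<And>i r. i < l \<Longrightarrow> r \<in> set (rs i) \<Longrightarrow> (\<exists>a\<in>A. r = [a]) \<or> set r \<inter> A = {}"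
    "\<And>i. i < l \<Longrightarrow> length (rs i) \<le> 2 * card A + 1"
    by metis
  have r_sub: "set r \<subseteq> set (P i)" "r \<noteq> []" "chain E r" "set r \<subseteq> V" "distinct r"
    if "i < l" "r \<in> set (rs i)" for i r
  proof -
    show sub: "set r \<subseteq> set (P i)" using rs(1)[OF that(1), symmetric] that(2) by auto
    show "r \<noteq> []" using rs(2) that by metis
    have *: "chain E (concat (rs i))" "distinct (concat (rs i))" "set (P i) \<subseteq> V"
      using path[OF that(1)] rs(1)[OF that(1)] by (auto simp: path_in_def)
    show "chain E r" using chain_concat[OF *(1) rs(2)[OF that(1)]] that(2) by blast
    show "set r \<subseteq> V" using sub *(3) by blast
    show "distinct r" using *(2) that(2) by (auto simp: distinct_concat_iff)
  qed
  define f where "f r = (hd r, last r)" for r :: "'a list"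
  define sk where "sk i = map f (rs i)" for i
  have hd_last: "hd r \<in> set r" "last r \<in> set r" if "i < l" "r \<in> set (rs i)" for i r
    using r_sub(2)[OF that] by auto
  have reach_hd: "reach E (V - A) (hd r) z" if "i < l" "r \<in> set (rs i)" "hd r \<noteq> last r" "z \<in> set r" for i r z
  proof -
    have "set r \<inter> A = {}" using rs(3)[OF that(1,2)] that(3) by auto
    then show ?thesis using r_sub[OF that(1,2)] that(4) by (intro chain_reach) auto
  qed
  have nth_disj: "set (rs i ! a) \<inter> set (rs j ! b) = {}"
    if "i < l" "j < l" "a < length (rs i)" "b < length (rs j)" "(i, a) \<noteq> (j, b)" for i j a b
  proof (cases "i = j")
    case True
    have d: "distinct (concat (rs i))" using path[OF that(1)] rs(1)[OF that(1)] by (simp add: path_in_def)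
    have "removeAll [] (rs i) = rs i" using rs(2)[OF that(1)] by simp
    then have "distinct (rs i)" using d by (simp add: distinct_concat_iff)
    then have "rs i ! a \<noteq> rs i ! b" using that True by (simp add: nth_eq_iff_index_eq)
    then show ?thesis using d that True unfolding distinct_concat_iff by simp
  next
    case False
    have "set (P i) \<inter> set (P j) = {}"
      using P that False by (simp add: hamiltonian_paths_def disjoint_family_on_def)
    moreover have "rs i ! a \<in> set (rs i)" "rs j ! b \<in> set (rs j)" using that by simp_all
    ultimately show ?thesis using r_sub(1) that(1,2) by blast
  qed
  have "skeleton A ss ts l sk"
    unfolding skeleton_def
  proof (intro conjI allI impI ballI)
    fix i assume i: "i < l"
    have ne: "rs i \<noteq> []" using rs(1)[OF i] path[OF i] by (auto simp: path_in_def)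
    then show "sk i \<noteq> []" by (simp add: sk_def)
    have "hd (P i) = hd (hd (rs i))"
      using hd_concat[OF ne] hd_in_set[OF ne] rs(1,2)[OF i] by metis
    then show "fst (hd (sk i)) = ss ! i"
      using path[OF i] ne by (simp add: sk_def f_def hd_map path_in_def)
    have "rs i = butlast (rs i) @ [last (rs i)]" using ne by simp
    then have "concat (rs i) = concat (butlast (rs i)) @ last (rs i)"
      by (metis concat.simps append_Nil2 concat_append)
    moreover have "last (rs i) \<noteq> []" using ne rs(2)[OF i] by (metis last_in_set)
    ultimately have "last (P i) = last (last (rs i))" using rs(1)[OF i] by simp
    then show "snd (last (sk i)) = ts ! i"
      using path[OF i] ne by (simp add: sk_def f_def last_map path_in_def)
    have "chain E (concat (rs i))" using path[OF i] rs(1)[OF i] by (simp add: path_in_def)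
    from chain_concat[OF this rs(2)[OF i]]
    show "successively (\<lambda>p q. (snd p, fst q) \<in> E) (sk i)"
      by (simp add: sk_def successively_map f_def)
  next
    fix i p assume i: "i < l" and "p \<in> set (sk i)"
    then obtain r where r: "r \<in> set (rs i)" "p = f r" by (auto simp: sk_def)
    show "fst p \<in> V" using hd_last[OF i r(1)] r_sub(4)[OF i r(1)] by (auto simp: r(2) f_def)
    show "fst p = snd p \<or> reach E (V - A) (fst p) (snd p)"
      using reach_hd[OF i r(1)] hd_last[OF i r(1)] by (auto simp: r(2) f_def)
  next
    fix i j a b
    assume *: "i < l" "j < l" "a < length (sk i)" "b < length (sk j)" "(i, a) \<noteq> (j, b)"
    then have ab: "a < length (rs i)" "b < length (rs j)" by (simp_all add: sk_def)
    have "{fst (sk i ! a), snd (sk i ! a)} \<subseteq> set (rs i ! a)"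
      using hd_last[OF *(1) nth_mem[OF ab(1)]] ab by (simp add: sk_def f_def)
    moreover have "{fst (sk j ! b), snd (sk j ! b)} \<subseteq> set (rs j ! b)"
      using hd_last[OF *(2) nth_mem[OF ab(2)]] ab by (simp add: sk_def f_def)
    ultimately show "{fst (sk i ! a), snd (sk i ! a)} \<inter> {fst (sk j ! b), snd (sk j ! b)} = {}"
      using nth_disj[OF *(1,2) ab *(5)] by blast
  next
    fix z assume "z \<in> V"
    then obtain i where i: "i < l" "z \<in> set (P i)"
      using P unfolding hamiltonian_paths_def by blast
    then obtain r where r: "r \<in> set (rs i)" "z \<in> set r" using rs(1)[OF i(1), symmetric] by auto
    have "f r \<in> set (sk i)" using r by (simp add: sk_def)
    moreover have "hd r = z \<and> last r = z \<or> hd r \<noteq> last r \<and> reach E (V - A) z (hd r)"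
    proof (cases "hd r = last r")
      case True
      \<comment> \<open>As vertices on a path do not repeat, a piece with equal ends is a single
        vertex; a trivial pair thus never hides a longer piece.\<close>
      then have "r = [z]" using r(2) r_sub(2,5)[OF i(1) r(1)] by (cases r) (auto split: if_splits)
      then show ?thesis by simp
    next
      case False
      then show ?thesis using reach_hd[OF i(1) r(1) _ r(2)] reach_sym[OF sym_E] by blast
    qed
    ultimately show "\<exists>i<l. \<exists>p\<in>set (sk i).
        fst p = z \<and> snd p = z \<or> fst p \<noteq> snd p \<and> reach E (V - A) z (fst p)"
      using i(1) by (intro exI[of _ i] conjI bexI[of _ "f r"]) (simp_all add: f_def)
  qed
  moreover have "\<forall>i<l. length (sk i) \<le> 2 * card A + 1" using rs(4) by (simp add: sk_def)
  ultimately show ?thesis by blast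
qed

end

section \<open>Predicates decidable by polynomial-time programs\<close>

text \<open>The base \<open>n + 2\<close> is at least 2 for all \<open>n\<close>, so constants and
  sums are absorbed by a larger exponent and no exception for small \<open>n\<close> arises.\<close>

definition poly_bounded :: "(nat \<Rightarrow> nat) \<Rightarrow> bool" where
  "poly_bounded T \<longleftrightarrow> (\<exists>c. \<forall>n. T n \<le> (n + 2) ^ c)"

lemma poly_bounded_const: "poly_bounded (\<lambda>_. a)"
proof -
  have "a \<le> (n + 2) ^ a" for n
  proof -
    have "a \<le> 2 ^ a" by (rule less_imp_le[OF less_exp])
    also have "\<dots> \<le> (n + 2) ^ a" by (rule power_mono) auto
    finally show ?thesis .
  qed
  then show ?thesis unfolding poly_bounded_def by blast
qed

lemma poly_bounded_id: "poly_bounded (\<lambda>n. n)"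
  unfolding poly_bounded_def by (rule exI[of _ 1]) simp

lemma poly_bounded_mult:
  assumes "poly_bounded T" "poly_bounded U"
  shows "poly_bounded (\<lambda>n. T n * U n)"
proof -
  obtain a b where "\<And>n. T n \<le> (n + 2) ^ a" "\<And>n. U n \<le> (n + 2) ^ b"
    using assms unfolding poly_bounded_def by blast
  then have "T n * U n \<le> (n + 2) ^ (a + b)" for n unfolding power_add by (intro mult_mono) auto
  then show ?thesis unfolding poly_bounded_def by blast
qed

lemma poly_bounded_add:
  assumes "poly_bounded T" "poly_bounded U"
  shows "poly_bounded (\<lambda>n. T n + U n)"
proof -
  obtain a b where ab: "\<And>n. T n \<le> (n + 2) ^ a" "\<And>n. U n \<le> (n + 2) ^ b"
    using assms unfolding poly_bounded_def by blast
  have "T n + U n \<le> (n + 2) ^ (a + b + 1)" for n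
  proof -
    have "(n + 2) ^ a \<le> (n + 2) ^ (a + b)" "(n + 2) ^ b \<le> (n + 2) ^ (a + b)"
      by (rule power_increasing; simp)+
    then have "T n + U n \<le> 2 * (n + 2) ^ (a + b)" using ab[of n] by linarith
    also have "\<dots> \<le> (n + 2) ^ (a + b + 1)" by simp
    finally show ?thesis .
  qed
  then show ?thesis unfolding poly_bounded_def by blast
qed

lemmas poly_bounded_intros =
  poly_bounded_const poly_bounded_id poly_bounded_mult poly_bounded_add

lemma poly_bounded_bigo:
  assumes "poly_bounded T"
  shows "\<exists>c. (\<lambda>n. real (T n)) \<in> O(\<lambda>n. real n ^ c)"
proof -
  obtain c where c: "\<And>n. T n \<le> (n + 2) ^ c" using assms unfolding poly_bounded_def by blast
  have "norm (real (T n)) \<le> 3 ^ c * norm (real n ^ c)" if "n \<ge> 1" for n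
  proof -
    have "n + 2 \<le> 3 * n" using that by simp
    then have "(n + 2) ^ c \<le> (3 * n) ^ c" by (rule power_mono) simp
    with c[of n] have "T n \<le> (3 * n) ^ c" by (rule le_trans)
    then have "real (T n) \<le> real ((3 * n) ^ c)" by (rule of_nat_mono)
    then show ?thesis by (simp add: power_mult_distrib)
  qed
  then show ?thesis
    by (intro exI bigoI[where c = "3 ^ c"] eventually_mono[OF eventually_ge_at_top[of 1]])
qed

section \<open>Memory layout and tests of atomic predicates and connectives\<close>

definition input_graph :: "nat pair_pre_digraph \<Rightarrow> bool" where
  "input_graph G \<longleftrightarrow> pair_graph G \<and> pverts G = {..<card (pverts G)}"

text \<open>
  Array 4 holds the values of variables, array 5 the numbers \<open>i * n\<close> (so that adjacency can be
  looked up without multiplication), and cell 0 of array 6 the result of a test.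
\<close>

definition represents :: "nat pair_pre_digraph \<Rightarrow> memory \<Rightarrow> bool" where
  "represents G m \<longleftrightarrow> (let n = card (pverts G) in
     m 0 0 = n \<and>
     m 1 = (\<lambda>j. of_bool (j < n * n \<and> (j div n, j mod n) \<in> parcs G)) \<and>
     (\<forall>i<n. m 5 i = i * n))"

text \<open>A stack discipline: variables of enclosing scopes occupy the cells below
  \<open>d\<close> of array 4, the cells from \<open>d\<close> on are free for nested quantifiers,
  and array 6 is scratch space.\<close>

definition frame :: "nat \<Rightarrow> memory \<Rightarrow> memory \<Rightarrow> bool" where
  "frame d m m' \<longleftrightarrow> (\<forall>a j. a \<notin> {4, 6} \<or> a = 4 \<and> j < d \<longrightarrow> m' a j = m a j)"

lemma frame_refl: "frame d m m"
  by (simp add: frame_def)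

lemma frame_trans: "frame d m m' \<Longrightarrow> frame d m' m'' \<Longrightarrow> frame d m m''"
  by (simp add: frame_def)

lemma frame_mono: "frame d m m' \<Longrightarrow> c \<le> d \<Longrightarrow> frame c m m'"
  by (simp add: frame_def)

lemma frame_update: "a = 4 \<and> d \<le> j \<or> a = 6 \<Longrightarrow> frame d m (m(a := (m a)(j := x)))"
  by (auto simp: frame_def)

lemma frame_represents:
  assumes "frame d m m'" "represents G m"
  shows "represents G m'"
proof -
  have "m' 0 0 = m 0 0" "m' 1 = m 1" "m' 5 = m 5"
    using assms(1) by (auto simp: frame_def fun_eq_iff)
  then show ?thesis using assms(2) by (simp add: represents_def Let_def)
qed

definition stores :: "nat pair_pre_digraph \<Rightarrow> (('e \<Rightarrow> nat) \<Rightarrow> nat) \<Rightarrow> ('e \<Rightarrow> nat) set \<Rightarrow>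
    'e \<Rightarrow> memory \<Rightarrow> bool" where
  "stores G loc A e m \<longleftrightarrow> input_graph G \<and> represents G m \<and>
     (\<forall>t\<in>A. t e \<in> pverts G \<and> m 4 (loc t) = t e)"

definition decides :: "program \<Rightarrow> (nat \<Rightarrow> nat) \<Rightarrow> nat \<Rightarrow> (('e \<Rightarrow> nat) \<Rightarrow> nat) \<Rightarrow> ('e \<Rightarrow> nat) set \<Rightarrow>
    (nat pair_pre_digraph \<Rightarrow> 'e \<Rightarrow> bool) \<Rightarrow> bool" where
  "decides p T d loc A Q \<longleftrightarrow> (\<forall>G e m. stores G loc A e m \<longrightarrow>
     (\<exists>u m'. exec p m u m' \<and> u \<le> T (card (pverts G)) \<and> m' 6 0 = of_bool (Q G e) \<and> frame d m m'))"

text \<open>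
  A predicate on environments \<open>e\<close> is given together with a set \<open>A\<close> of variables, viewed as
  accessor functions on environments; \<open>loc\<close> assigns memory cells to them. Quantifiers pair the
  environment with a new component.
\<close>

definition checkable :: "('e \<Rightarrow> nat) set \<Rightarrow> (nat pair_pre_digraph \<Rightarrow> 'e \<Rightarrow> bool) \<Rightarrow> bool" where
  "checkable A Q \<longleftrightarrow> (\<forall>d loc. loc ` A \<subseteq> {..<d} \<longrightarrow>
     (\<exists>p T. poly_bounded T \<and> decides p T d loc A Q))"

lemma stores_frame:
  assumes "frame d m m'" "loc ` A \<subseteq> {..<d}" "stores G loc A e m"
  shows "stores G loc A e m'"
  using assms frame_represents[OF assms(1)] unfolding stores_def
  by (auto simp: frame_def image_subset_iff)

lemma decidesE:
  assumes "decides p T d loc A Q" "stores G loc A e m"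
  obtains u m' where "exec p m u m'" "u \<le> T (card (pverts G))" "m' 6 0 = of_bool (Q G e)" "frame d m m'"
  using assms unfolding decides_def by blast

lemma checkableE:
  assumes "checkable A Q" "loc ` A \<subseteq> {..<d}"
  obtains p T where "poly_bounded T" "decides p T d loc A Q"
  using assms unfolding checkable_def by blast

text \<open>The same program works: an accessor \<open>t\<close> of \<open>A\<close> is looked up in
  the cell of the accessor \<open>t \<circ> h\<close> of \<open>B\<close>. This allows environments
  to be regrouped without moving data in memory.\<close>

lemma checkable_pullback:
  assumes "checkable A Q" "(\<lambda>t. t \<circ> h) ` A \<subseteq> B"
  shows "checkable B (\<lambda>G e. Q G (h e))"
  unfolding checkable_def
proof (intro allI impI)
  fix d and loc :: "('b \<Rightarrow> nat) \<Rightarrow> nat"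
  assume loc: "loc ` B \<subseteq> {..<d}"
  have "(\<lambda>t. loc (t \<circ> h)) ` A \<subseteq> {..<d}" using loc assms(2) by blast
  with assms(1) obtain p T where pT: "poly_bounded T" "decides p T d (\<lambda>t. loc (t \<circ> h)) A Q"
    by (rule checkableE)
  have "decides p T d loc B (\<lambda>G e. Q G (h e))"
    unfolding decides_def
  proof (intro allI impI)
    fix G e m assume "stores G loc B e m"
    then have "stores G (\<lambda>t. loc (t \<circ> h)) A (h e) m"
      using assms(2) unfolding stores_def by fastforce
    with pT(2) show "\<exists>u m'. exec p m u m' \<and> u \<le> T (card (pverts G)) \<and>
        m' 6 0 = of_bool (Q G (h e)) \<and> frame d m m'"
      unfolding decides_def by blast
  qed
  then show "\<exists>p T. poly_bounded T \<and> decides p T d loc B (\<lambda>G e. Q G (h e))" using pT(1) by blast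
qed

lemma checkable_cong:
  assumes "checkable A Q"
    and eq: "\<And>G e. input_graph G \<Longrightarrow> \<forall>t\<in>A. t e \<in> pverts G \<Longrightarrow> Q G e \<longleftrightarrow> Q' G e"
  shows "checkable A Q'"
proof -
  have *: "decides p T d loc A Q'" if "decides p T d loc A Q" for p T d loc
    unfolding decides_def
  proof (intro allI impI)
    fix G e m assume h: "stores G loc A e m"
    then have "Q G e \<longleftrightarrow> Q' G e" unfolding stores_def by (intro eq) auto
    moreover obtain u m' where "exec p m u m'" "u \<le> T (card (pverts G))"
      "m' 6 0 = of_bool (Q G e)" "frame d m m'"
      using \<open>decides p T d loc A Q\<close> h by (rule decidesE)
    ultimately show "\<exists>u m'. exec p m u m' \<and> u \<le> T (card (pverts G)) \<and>
        m' 6 0 = of_bool (Q' G e) \<and> frame d m m'"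
      by (intro exI[of _ u] exI[of _ m']) simp
  qed
  show ?thesis unfolding checkable_def
  proof (intro allI impI)
    fix d and loc :: "('a \<Rightarrow> nat) \<Rightarrow> nat"
    assume "loc ` A \<subseteq> {..<d}"
    with assms(1) obtain p T where "poly_bounded T" "decides p T d loc A Q" by (rule checkableE)
    then show "\<exists>p T. poly_bounded T \<and> decides p T d loc A Q'" using * by blast
  qed
qed

lemma exec_Write:
  assumes "u = 1 + expr_time i + expr_time e"
    and "m' = m(a := (m a)(expr_val i m := expr_val e m))"
  shows "exec (Write a i e) m u m'"
  unfolding assms by (rule exec.Write)

lemma exec_While_done:
  assumes "expr_val b m = 0" "u = 1 + expr_time b"
  shows "exec (While b p) m u m"
  unfolding assms(2) using assms(1) by (rule exec.WhileFalse)

text \<open>Atomic tests need no loop: one expression, depending only on the cells of the variables,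
  is evaluated in constant time.\<close>

lemma checkable_expr:
  assumes val: "\<And>loc G e m. stores G loc A e m \<Longrightarrow> expr_val (x loc) m = of_bool (Q G e)"
  shows "checkable A Q"
  unfolding checkable_def
proof (intro allI impI)
  fix d and loc :: "('a \<Rightarrow> nat) \<Rightarrow> nat"
  let ?p = "Write 6 (Const 0) (x loc)" and ?T = "2 + expr_time (x loc)"
  have "decides ?p (\<lambda>_. ?T) d loc A Q"
    unfolding decides_def
  proof (intro allI impI)
    fix G e m assume h: "stores G loc A e m"
    let ?m = "m(6 := (m 6)(0 := expr_val (x loc) m))"
    have "exec ?p m ?T ?m" by (rule exec_Write) simp_all
    moreover have "frame d m ?m" by (rule frame_update) simp
    moreover have "?m 6 0 = of_bool (Q G e)" using val[OF h] by simp
    ultimately show "\<exists>u m'. exec ?p m u m' \<and> u \<le> ?T \<and> m' 6 0 = of_bool (Q G e) \<and> frame d m m'"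
      by (intro exI[of _ ?T] exI[of _ ?m] conjI) simp_all
  qed
  then show "\<exists>p T. poly_bounded T \<and> decides p T d loc A Q" using poly_bounded_const by blast
qed

lemma checkable_const: "checkable A (\<lambda>_ _. b)"
  by (rule checkable_expr[where x = "\<lambda>_. Const (of_bool b)"]) simp

lemma checkable_eq:
  assumes "s \<in> A" "t \<in> A"
  shows "checkable A (\<lambda>G e. s e = t e)"
proof (rule checkable_expr)
  fix loc G e m
  assume h: "stores G loc A e m"
  let ?s = "Read 4 (Const (loc s))" and ?t = "Read 4 (Const (loc t))"
  \<comment> \<open>Subtraction is truncated, so the sum of both differences vanishes exactly when
    the values agree.\<close>
  show "expr_val (Minus (Const 1) (Plus (Minus ?s ?t) (Minus ?t ?s))) m = of_bool (s e = t e)"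
    using h assms by (simp add: stores_def)
qed

lemma checkable_adj:
  assumes "s \<in> A" "t \<in> A"
  shows "checkable A (\<lambda>G e. (s e, t e) \<in> parcs G)"
proof (rule checkable_expr)
  fix loc G e m
  assume h: "stores G loc A e m"
  let ?s = "Read 4 (Const (loc s))" and ?t = "Read 4 (Const (loc t))" and ?n = "card (pverts G)"
  have V: "s e < ?n" "t e < ?n"
    using h assms unfolding stores_def input_graph_def by (metis lessThan_iff)+
  \<comment> \<open>The index must lie below \<open>?n * ?n\<close>, since array 1 is zero beyond
    the matrix.\<close>
  have "s e * ?n + t e < s e * ?n + ?n" using V by simp
  also have "\<dots> = Suc (s e) * ?n" by simp
  also have "\<dots> \<le> ?n * ?n" using V by (intro mult_le_mono1) simp
  finally have "s e * ?n + t e < ?n * ?n" .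
  then show "expr_val (Read 1 (Plus (Read 5 ?s) ?t)) m = of_bool ((s e, t e) \<in> parcs G)"
    using h assms V by (simp add: stores_def represents_def Let_def)
qed

lemma checkable_not:
  assumes "checkable A Q"
  shows "checkable A (\<lambda>G e. \<not> Q G e)"
  unfolding checkable_def
proof (intro allI impI)
  fix d and loc :: "('a \<Rightarrow> nat) \<Rightarrow> nat"
  assume "loc ` A \<subseteq> {..<d}"
  with assms obtain p T where pT: "poly_bounded T" "decides p T d loc A Q" by (rule checkableE)
  let ?w = "Write 6 (Const 0) (Minus (Const 1) (Read 6 (Const 0)))"
  have "decides (Seq p ?w) (\<lambda>n. T n + 6) d loc A (\<lambda>G e. \<not> Q G e)"
    unfolding decides_def
  proof (intro allI impI)
    fix G e m assume "stores G loc A e m"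
    with pT(2) obtain u m' where *: "exec p m u m'" "u \<le> T (card (pverts G))"
      "m' 6 0 = of_bool (Q G e)" "frame d m m'" by (rule decidesE)
    let ?m = "m'(6 := (m' 6)(0 := 1 - m' 6 0))"
    have "exec ?w m' 6 ?m" by (rule exec_Write) simp_all
    with *(1) have "exec (Seq p ?w) m (u + 6) ?m" by (rule Seq)
    moreover have "frame d m ?m" using *(4) by (rule frame_trans) (auto intro: frame_update)
    ultimately show "\<exists>u m'. exec (Seq p ?w) m u m' \<and> u \<le> T (card (pverts G)) + 6 \<and>
        m' 6 0 = of_bool (\<not> Q G e) \<and> frame d m m'"
      using * by (intro exI[of _ "u + 6"] exI[of _ ?m]) auto
  qed
  moreover have "poly_bounded (\<lambda>n. T n + 6)" using pT(1) by (intro poly_bounded_intros)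
  ultimately show "\<exists>p T. poly_bounded T \<and> decides p T d loc A (\<lambda>G e. \<not> Q G e)" by blast
qed

lemma checkable_conj:
  assumes "checkable A Q" "checkable A R"
  shows "checkable A (\<lambda>G e. Q G e \<and> R G e)"
  unfolding checkable_def
proof (intro allI impI)
  fix d and loc :: "('a \<Rightarrow> nat) \<Rightarrow> nat"
  assume loc: "loc ` A \<subseteq> {..<d}"
  obtain p T where pT: "poly_bounded T" "decides p T d loc A Q"
    using assms(1) loc by (rule checkableE)
  obtain q U where qU: "poly_bounded U" "decides q U d loc A R"
    using assms(2) loc by (rule checkableE)
  let ?b = "Read 6 (Const 0)"
  let ?p = "Seq p (Cond ?b q Skip)" and ?T = "\<lambda>n. T n + U n + 4"
  have "decides ?p ?T d loc A (\<lambda>G e. Q G e \<and> R G e)"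
    unfolding decides_def
  proof (intro allI impI)
    fix G e m assume h: "stores G loc A e m"
    with pT(2) obtain u m' where *: "exec p m u m'" "u \<le> T (card (pverts G))"
      "m' 6 0 = of_bool (Q G e)" "frame d m m'" by (rule decidesE)
    show "\<exists>u m'. exec ?p m u m' \<and> u \<le> ?T (card (pverts G)) \<and>
        m' 6 0 = of_bool (Q G e \<and> R G e) \<and> frame d m m'"
    proof (cases "Q G e")
      case True
      have "stores G loc A e m'" using *(4) loc h by (rule stores_frame)
      with qU(2) obtain v m'' where **: "exec q m' v m''" "v \<le> U (card (pverts G))"
        "m'' 6 0 = of_bool (R G e)" "frame d m' m''" by (rule decidesE)
      have "exec (Cond ?b q Skip) m' (1 + expr_time ?b + v) m''"
        using *(3) True **(1) by (intro CondTrue) simp_all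
      then have "exec ?p m (u + (1 + expr_time ?b + v)) m''" using *(1) by (intro Seq)
      moreover have "frame d m m''" using *(4) **(4) by (rule frame_trans)
      ultimately show ?thesis using *(2) ** True
        by (intro exI[of _ "u + (1 + expr_time ?b + v)"] exI[of _ m'']) auto
    next
      case False
      have "exec (Cond ?b q Skip) m' (1 + expr_time ?b + 1) m'"
        using *(3) False by (intro CondFalse Skip) simp_all
      then have "exec ?p m (u + (1 + expr_time ?b + 1)) m'" using *(1) by (intro Seq)
      then show ?thesis using * False
        by (intro exI[of _ "u + (1 + expr_time ?b + 1)"] exI[of _ m']) auto
    qed
  qed
  moreover have "poly_bounded ?T" using pT(1) qU(1) by (intro poly_bounded_intros)
  ultimately show "\<exists>p T. poly_bounded T \<and> decides p T d loc A (\<lambda>G e. Q G e \<and> R G e)" by blast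
qed

lemma checkable_disj:
  assumes "checkable A Q" "checkable A R"
  shows "checkable A (\<lambda>G e. Q G e \<or> R G e)"
  using checkable_not[OF checkable_conj[OF checkable_not[OF assms(1)] checkable_not[OF assms(2)]]]
  by simp

lemma checkable_imp:
  assumes "checkable A Q" "checkable A R"
  shows "checkable A (\<lambda>G e. Q G e \<longrightarrow> R G e)"
  using checkable_disj[OF checkable_not[OF assms(1)] assms(2)] by simp

lemma checkable_Ball:
  assumes "finite I" "\<And>i. i \<in> I \<Longrightarrow> checkable A (Q i)"
  shows "checkable A (\<lambda>G e. \<forall>i\<in>I. Q i G e)"
  using assms
proof (induction I rule: finite_induct)
  case empty
  then show ?case by (simp add: checkable_const)
next
  case (insert i I)
  then have "checkable A (\<lambda>G e. Q i G e \<and> (\<forall>i\<in>I. Q i G e))" by (intro checkable_conj) auto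
  then show ?case by simp
qed

lemma checkable_Bex:
  assumes "finite I" "\<And>i. i \<in> I \<Longrightarrow> checkable A (Q i)"
  shows "checkable A (\<lambda>G e. \<exists>i\<in>I. Q i G e)"
  using checkable_not[OF checkable_Ball[of I A "\<lambda>i G e. \<not> Q i G e", OF assms(1)]] assms(2)
  by (simp add: checkable_not)

section \<open>Quantification over vertices by exhaustive search\<close>

abbreviation extend_vars :: "('e \<Rightarrow> nat) set \<Rightarrow> ('e \<times> 'x \<Rightarrow> nat) set" where
  "extend_vars A \<equiv> (\<lambda>t p. t (fst p)) ` A"

lemma extend_varsI: "t \<in> A \<Longrightarrow> (\<lambda>p. t (fst p)) \<in> extend_vars A"
  by blast

text \<open>Cell \<open>d\<close> of array 4 is the loop counter, and \<open>r\<close> counts the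
  candidates left. A success sets the counter to \<open>n\<close>, so the loop ends with the result
  bit still 1. A failure leaves the bit 0, which is therefore the right answer when the candidates
  run out. The 20 generously bounds the overhead of a round and of the final test.\<close>

lemma search_loop:
  fixes d :: nat and p :: program
  defines "loop \<equiv> While (Minus (Read 0 (Const 0)) (Read 4 (Const d)))
    (Seq p (Cond (Read 6 (Const 0)) (Write 4 (Const d) (Read 0 (Const 0)))
      (Write 4 (Const d) (Plus (Read 4 (Const d)) (Const 1)))))"
  assumes p: "decides p T (Suc d) loc' (insert snd (extend_vars A)) (\<lambda>G p. Q G (fst p) (snd p))"
    and loc: "loc ` A \<subseteq> {..<d}" and loc': "loc' snd = d" "\<And>t. t \<in> A \<Longrightarrow> loc' (\<lambda>p. t (fst p)) = loc t"
    and m: "stores G loc A e m" "m 4 d + r = card (pverts G)" "m 6 0 = 0"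
  shows "\<exists>u m'. exec loop m u m' \<and> u \<le> r * (T (card (pverts G)) + 20) + 20 \<and>
    m' 6 0 = of_bool (\<exists>x\<in>{m 4 d..<card (pverts G)}. Q G e x) \<and> frame d m m'"
  using m
proof (induction r arbitrary: m)
  case 0
  then have "m 0 0 = card (pverts G)" by (simp add: stores_def represents_def Let_def)
  then have "exec loop m 6 m" unfolding loop_def
    using 0 by (intro exec_While_done) simp_all
  then show ?case using 0 frame_refl by (intro exI[of _ 6] exI[of _ m]) simp
next
  case (Suc r)
  let ?n = "card (pverts G)" and ?x = "m 4 d"
  let ?b = "Minus (Read 0 (Const 0)) (Read 4 (Const d))" and ?c = "Read 6 (Const 0)"
  let ?yes = "Write 4 (Const d) (Read 0 (Const 0))"
  let ?no = "Write 4 (Const d) (Plus (Read 4 (Const d)) (Const 1))"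
  have x: "?x < ?n" using Suc.prems by simp
  have m_0: "m 0 0 = ?n" using Suc.prems by (simp add: stores_def represents_def Let_def)
  have V: "pverts G = {..<?n}" using Suc.prems(1) by (simp add: stores_def input_graph_def)
  have "?x \<in> pverts G" using x V by blast
  then have "stores G loc' (insert snd (extend_vars A)) (e, ?x) m"
    using Suc.prems(1) loc' by (auto simp: stores_def)
  with p obtain u m1 where m1: "exec p m u m1" "u \<le> T ?n" "m1 6 0 = of_bool (Q G e ?x)"
    "frame (Suc d) m m1" by (rule decidesE) auto
  have m1_vals: "m1 0 0 = ?n" "m1 4 d = ?x" using m1(4) m_0 by (simp_all add: frame_def)
  have test: "expr_val ?b m \<noteq> 0" using m_0 x by simp
  have m1_frame: "frame d m m1" using m1(4) by (rule frame_mono) simp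
  show ?case
  proof (cases "Q G e ?x")
    case True
    let ?m2 = "m1(4 := (m1 4)(d := ?n))"
    have "exec ?yes m1 4 ?m2" by (rule exec_Write) (simp_all add: m1_vals)
    then have "exec (Cond ?c ?yes ?no) m1 (1 + expr_time ?c + 4) ?m2"
      using m1(3) True by (intro CondTrue) simp_all
    with m1(1) have body: "exec (Seq p (Cond ?c ?yes ?no)) m (u + (1 + expr_time ?c + 4)) ?m2"
      by (rule Seq)
    have "exec loop ?m2 6 ?m2" unfolding loop_def
      by (rule exec_While_done) (simp_all add: m1_vals)
    then have "exec loop m (1 + expr_time ?b + (u + (1 + expr_time ?c + 4)) + 6) ?m2"
      using WhileTrue[OF test body] unfolding loop_def by blast
    moreover have "frame d m ?m2" using m1_frame by (rule frame_trans) (simp add: frame_update)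
    moreover have "\<exists>x\<in>{?x..<?n}. Q G e x" using True x by auto
    then have "?m2 6 0 = of_bool (\<exists>x\<in>{?x..<?n}. Q G e x)" using m1(3) True by simp
    moreover have "1 + expr_time ?b + (u + (1 + expr_time ?c + 4)) + 6 \<le> Suc r * (T ?n + 20) + 20"
      using m1(2) by simp
    ultimately show ?thesis by blast
  next
    case False
    let ?m2 = "m1(4 := (m1 4)(d := Suc ?x))"
    have "exec ?no m1 6 ?m2"
      by (rule exec_Write) (simp_all add: m1_vals)
    then have "exec (Cond ?c ?yes ?no) m1 (1 + expr_time ?c + 6) ?m2"
      using m1(3) False by (intro CondFalse) simp_all
    with m1(1) have body: "exec (Seq p (Cond ?c ?yes ?no)) m (u + (1 + expr_time ?c + 6)) ?m2"
      by (rule Seq)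
    have fr: "frame d m ?m2" using m1_frame by (rule frame_trans) (simp add: frame_update)
    have "stores G loc A e ?m2" using fr loc Suc.prems(1) by (rule stores_frame)
    moreover have "?m2 4 d + r = ?n" using Suc.prems by simp
    moreover have "?m2 6 0 = 0" using m1(3) False by simp
    ultimately obtain v m3 where m3: "exec loop ?m2 v m3" "v \<le> r * (T ?n + 20) + 20"
      "m3 6 0 = of_bool (\<exists>x\<in>{?m2 4 d..<?n}. Q G e x)" "frame d ?m2 m3"
      using Suc.IH by blast
    have "exec loop m (1 + expr_time ?b + (u + (1 + expr_time ?c + 6)) + v) m3"
      using WhileTrue[OF test body] m3(1) unfolding loop_def by blast
    moreover have "frame d m m3" using fr m3(4) by (rule frame_trans)
    moreover have "(\<exists>x\<in>{?m2 4 d..<?n}. Q G e x) \<longleftrightarrow> (\<exists>x\<in>{?x..<?n}. Q G e x)"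
    proof -
      have "{?x..<?n} = insert ?x {?m2 4 d..<?n}" using x by auto
      then show ?thesis using False by simp
    qed
    ultimately show ?thesis using m1(2) m3
      by (intro exI[of _ "1 + expr_time ?b + (u + (1 + expr_time ?c + 6)) + v"] exI[of _ m3]) auto
  qed
qed

lemma checkable_ex_vertex:
  assumes "checkable (insert snd (extend_vars A)) (\<lambda>G p. Q G (fst p) (snd p))"
  shows "checkable A (\<lambda>G e. \<exists>x\<in>pverts G. Q G e x)"
  unfolding checkable_def
proof (intro allI impI)
  fix d and loc :: "('a \<Rightarrow> nat) \<Rightarrow> nat"
  assume loc: "loc ` A \<subseteq> {..<d}"
  \<comment> \<open>The new variable gets the first free cell \<open>d\<close>. A lifted accessor
    ignores the new component, so the dummy value 0 recovers the original accessor.\<close>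
  define loc' :: "('a \<times> nat \<Rightarrow> nat) \<Rightarrow> nat"
    where "loc' t = (if t = snd then d else loc (\<lambda>e. t (e, 0)))" for t
  \<comment> \<open>If an old variable coincided with \<open>snd\<close> as a function,
    \<open>loc'\<close> would assign it the cell of the new variable.\<close>
  have "(\<lambda>p. t (fst p)) \<noteq> snd" for t :: "'a \<Rightarrow> nat"
  proof
    assume "(\<lambda>p. t (fst p)) = snd"
    then have "t (fst (undefined, n)) = snd (undefined :: 'a, n)" for n by (rule fun_cong)
    from this[of 0] this[of 1] show False by simp
  qed
  then have loc': "loc' snd = d" "loc' (\<lambda>p. t (fst p)) = loc t" for t by (simp_all add: loc'_def)
  then have "loc' ` insert snd (extend_vars A) \<subseteq> {..<Suc d}" using loc by (auto simp: less_Suc_eq)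
  with assms obtain p T where pT: "poly_bounded T"
    "decides p T (Suc d) loc' (insert snd (extend_vars A)) (\<lambda>G p. Q G (fst p) (snd p))"
    by (rule checkableE)
  let ?loop = "While (Minus (Read 0 (Const 0)) (Read 4 (Const d)))
    (Seq p (Cond (Read 6 (Const 0)) (Write 4 (Const d) (Read 0 (Const 0)))
      (Write 4 (Const d) (Plus (Read 4 (Const d)) (Const 1)))))"
  let ?w1 = "Write 4 (Const d) (Const 0)" and ?w2 = "Write 6 (Const 0) (Const 0)"
  let ?p = "Seq ?w1 (Seq ?w2 ?loop)" and ?T = "\<lambda>n. n * (T n + 20) + 26"
  have "decides ?p ?T d loc A (\<lambda>G e. \<exists>x\<in>pverts G. Q G e x)"
    unfolding decides_def
  proof (intro allI impI)
    fix G e m assume h: "stores G loc A e m"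
    let ?n = "card (pverts G)"
    let ?m1 = "m(4 := (m 4)(d := 0))" 
    let ?m2 = "?m1(6 := (?m1 6)(0 := 0))"
    have w: "exec ?w1 m 3 ?m1" "exec ?w2 ?m1 3 ?m2" by (rule exec_Write; simp)+
    have "frame d m ?m1" "frame d ?m1 ?m2" by (rule frame_update; simp)+
    then have fr: "frame d m ?m2" by (rule frame_trans)
    have "stores G loc A e ?m2" using fr loc h by (rule stores_frame)
    moreover have "?m2 4 d = 0" "?m2 6 0 = 0" by simp_all
    ultimately obtain u m3 where m3: "exec ?loop ?m2 u m3" "u \<le> ?n * (T ?n + 20) + 20"
      "m3 6 0 = of_bool (\<exists>x\<in>{0..<?n}. Q G e x)" "frame d ?m2 m3"
      using search_loop[OF pT(2) loc loc', of G e ?m2 ?n] by auto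
    have "exec ?p m (3 + (3 + u)) m3" using w m3(1) by (intro Seq)
    moreover have "frame d m m3" using fr m3(4) by (rule frame_trans)
    moreover have "pverts G = {0..<?n}" using h by (auto simp: stores_def input_graph_def)
    ultimately show "\<exists>u m'. exec ?p m u m' \<and> u \<le> ?T ?n \<and>
        m' 6 0 = of_bool (\<exists>x\<in>pverts G. Q G e x) \<and> frame d m m'"
      using m3 by (intro exI[of _ "3 + (3 + u)"] exI[of _ m3]) auto
  qed
  moreover have "poly_bounded ?T" using pT(1) by (intro poly_bounded_intros)
  ultimately show "\<exists>p T. poly_bounded T \<and> decides p T d loc A (\<lambda>G e. \<exists>x\<in>pverts G. Q G e x)"
    by blast
qed

text \<open>One nested loop per index: by induction, a tuple on \<open>insert i I\<close> is a tuple
  on \<open>I\<close> followed by an innermost choice of its value at \<open>i\<close>. The exponent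
  of the running time thus grows with \<open>card I\<close>, which is constant for the
  program.\<close>

lemma checkable_ex_tuple:
  fixes Q :: "nat pair_pre_digraph \<Rightarrow> 'e \<Rightarrow> ('i \<Rightarrow> nat) \<Rightarrow> bool"
  assumes "finite I" "checkable (extend_vars A \<union> (\<lambda>i p. snd p i) ` I) (\<lambda>G p. Q G (fst p) (snd p))"
  shows "checkable A (\<lambda>G e. \<exists>x\<in>I \<rightarrow>\<^sub>E pverts G. Q G e x)"
  using assms
proof (induction I arbitrary: Q rule: finite_induct)
  case empty
  let ?A = "extend_vars A \<union> (\<lambda>i p. snd p i) ` {} :: ('e \<times> ('i \<Rightarrow> nat) \<Rightarrow> nat) set"
  have "(\<lambda>t. t \<circ> (\<lambda>e. (e, \<lambda>_. undefined))) ` ?A \<subseteq> A" by (auto simp: comp_def)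
  from checkable_pullback[OF empty this] show ?case by simp
next
  case (insert i I)
  \<comment> \<open>The innermost vertex is folded into the tuple as its value at \<open>i\<close>;
    by \<open>checkable_pullback\<close> this reinterpretation costs nothing.\<close>
  define h :: "('e \<times> ('i \<Rightarrow> nat)) \<times> nat \<Rightarrow> 'e \<times> ('i \<Rightarrow> nat)"
    where "h = (\<lambda>p. (fst (fst p), (snd (fst p))(i := snd p)))"
  let ?A = "extend_vars A \<union> (\<lambda>i p. snd p i) ` I :: ('e \<times> ('i \<Rightarrow> nat) \<Rightarrow> nat) set"
  have "(\<lambda>p. snd p j) \<circ> h \<in> insert snd (extend_vars ?A)" if "j \<in> insert i I" for j
  proof (cases "j = i")
    case True
    then show ?thesis by (simp add: comp_def h_def)
  next
    case False
    then have "(\<lambda>p. snd p j) \<circ> h = (\<lambda>q. (\<lambda>p. snd p j) (fst q))" by (auto simp: h_def fun_eq_iff)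
    moreover have "(\<lambda>p. snd p j) \<in> ?A" using that False by blast
    ultimately show ?thesis using extend_varsI[of "\<lambda>p. snd p j" ?A] by simp
  qed
  moreover have "(\<lambda>p. t (fst p)) \<circ> h \<in> insert snd (extend_vars ?A)" if "t \<in> A" for t
  proof -
    have "(\<lambda>p. t (fst p)) \<circ> h = (\<lambda>q. (\<lambda>p. t (fst p)) (fst q))" by (auto simp: h_def fun_eq_iff)
    moreover have "(\<lambda>p. t (fst p)) \<in> ?A" using that by blast
    ultimately show ?thesis using extend_varsI[of "\<lambda>p. t (fst p)" ?A] by simp
  qed
  ultimately have "checkable (insert snd (extend_vars ?A)) (\<lambda>G p. Q G (fst (h p)) (snd (h p)))"
    by (intro checkable_pullback[OF insert.prems]) blast
  then have "checkable ?A (\<lambda>G p. \<exists>y\<in>pverts G. Q G (fst p) ((snd p)(i := y)))"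
    by (intro checkable_ex_vertex) (simp add: h_def)
  then have "checkable A (\<lambda>G e. \<exists>x\<in>I \<rightarrow>\<^sub>E pverts G. \<exists>y\<in>pverts G. Q G e (x(i := y)))"
    by (rule insert.IH)
  moreover have "(\<exists>x\<in>insert i I \<rightarrow>\<^sub>E V. R x) \<longleftrightarrow> (\<exists>x\<in>I \<rightarrow>\<^sub>E V. \<exists>y\<in>V. R (x(i := y)))"
    for V :: "nat set" and R :: "('i \<Rightarrow> nat) \<Rightarrow> bool"
    unfolding PiE_insert_eq by auto
  ultimately show ?case by simp
qed


text \<open>The formulas quantify over arbitrary functions of which only the values on
  \<open>I\<close> matter; restricting a witness to \<open>I\<close> makes it one of the finitely
  many searched tuples.\<close>

lemma checkable_ex_restricted_tuple:
  assumes "finite I" "checkable (extend_vars A \<union> (\<lambda>i p. snd p i) ` I) (\<lambda>G p. Q G (fst p) (snd p))"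
    and "\<And>G e x y. (\<And>i. i \<in> I \<Longrightarrow> x i = y i) \<Longrightarrow> Q G e x = Q G e y"
  shows "checkable A (\<lambda>G e. \<exists>x. (\<forall>i\<in>I. x i \<in> pverts G) \<and> Q G e x)"
proof (rule checkable_cong[OF checkable_ex_tuple[OF assms(1,2)]])
  fix G e
  show "(\<exists>x\<in>I \<rightarrow>\<^sub>E pverts G. Q G e x) \<longleftrightarrow> (\<exists>x. (\<forall>i\<in>I. x i \<in> pverts G) \<and> Q G e x)"
  proof
    assume "\<exists>x. (\<forall>i\<in>I. x i \<in> pverts G) \<and> Q G e x"
    then obtain x where x: "\<forall>i\<in>I. x i \<in> pverts G" "Q G e x" by blast
    have "Q G e (restrict x I)" using x(2) assms(3)[of x "restrict x I"] by simp
    then show "\<exists>x\<in>I \<rightarrow>\<^sub>E pverts G. Q G e x" using x(1) by (intro bexI[of _ "restrict x I"]) auto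
  qed auto
qed

section \<open>Preparing the memory and returning the answer\<close>

primrec copy_array :: "nat \<Rightarrow> nat \<Rightarrow> nat \<Rightarrow> program" where
  "copy_array a s 0 = Skip"
| "copy_array a s (Suc i) = Seq (copy_array a s i) (Write 4 (Const (s + i)) (Read a (Const i)))"

text \<open>The number of copied cells is part of the program text, so copying is straight-line
  code: 4 steps per cell and 1 for \<open>Skip\<close>. Array 4 is excluded as source because it is
  being overwritten.\<close>

lemma exec_copy_array:
  assumes "a \<noteq> 4"
  shows "exec (copy_array a s l) m (1 + 4 * l)
    (m(4 := (\<lambda>j. if s \<le> j \<and> j < s + l then m a (j - s) else m 4 j)))"
proof (induction l)
  case 0
  have "m(4 := (\<lambda>j. if s \<le> j \<and> j < s + 0 then m a (j - s) else m 4 j)) = m"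
    by (auto simp: fun_eq_iff)
  then show ?case using exec.Skip[of m] by simp
next
  case (Suc l)
  let ?m = "\<lambda>l. m(4 := (\<lambda>j. if s \<le> j \<and> j < s + l then m a (j - s) else m 4 j))"
  have "exec (Write 4 (Const (s + l)) (Read a (Const l))) (?m l) 4 (?m (Suc l))"
    using assms by (intro exec_Write) (auto simp: fun_eq_iff)
  with Suc have "exec (copy_array a s (Suc l)) m (1 + 4 * l + 4) (?m (Suc l))"
    unfolding copy_array.simps by (rule exec.Seq)
  moreover have "1 + 4 * l + 4 = 1 + 4 * Suc l" by simp
  ultimately show ?case by (simp only:)
qed

definition row_offsets :: program where
  "row_offsets = While (Minus (Read 0 (Const 0)) (Read 6 (Const 0)))
    (Seq (Write 5 (Plus (Read 6 (Const 0)) (Const 1)) (Plus (Read 5 (Read 6 (Const 0))) (Read 0 (Const 0))))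
      (Write 6 (Const 0) (Plus (Read 6 (Const 0)) (Const 1))))"

text \<open>The products are tabulated by repeated addition, with cell 0 of array 6 as counter. A
  round takes 6 steps for the test and 11 + 6 for the two writes; the last test takes 6.\<close>

lemma exec_row_offsets:
  assumes "m 0 0 = n" "m 6 0 + r = n" "\<And>i. i \<le> m 6 0 \<Longrightarrow> m 5 i = i * n"
  shows "\<exists>m'. exec row_offsets m (6 + 23 * r) m' \<and>
    (\<forall>i\<le>n. m' 5 i = i * n) \<and> (\<forall>a. a \<noteq> 5 \<and> a \<noteq> 6 \<longrightarrow> m' a = m a)"
  using assms
proof (induction r arbitrary: m)
  case 0
  have "exec row_offsets m 6 m" unfolding row_offsets_def
    using 0 by (intro exec_While_done) simp_all
  then show ?case using 0 by (intro exI[of _ m]) simp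
next
  case (Suc r)
  let ?b = "Minus (Read 0 (Const 0)) (Read 6 (Const 0))"
  let ?w1 = "Write 5 (Plus (Read 6 (Const 0)) (Const 1)) (Plus (Read 5 (Read 6 (Const 0))) (Read 0 (Const 0)))"
  let ?w2 = "Write 6 (Const 0) (Plus (Read 6 (Const 0)) (Const 1))"
  let ?x = "m 6 0"
  let ?m1 = "m(5 := (m 5)(Suc ?x := Suc ?x * n))"
  let ?m2 = "?m1(6 := (?m1 6)(0 := Suc ?x))"
  have "m 5 ?x = ?x * n" using Suc.prems(3) by simp
  then have "exec ?w1 m 11 ?m1"
    using Suc.prems(1) by (intro exec_Write) (simp_all add: add.commute)
  moreover have "exec ?w2 ?m1 6 ?m2" by (rule exec_Write) simp_all
  ultimately have body: "exec (Seq ?w1 ?w2) m (11 + 6) ?m2" by (rule Seq)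
  have test: "expr_val ?b m \<noteq> 0" using Suc.prems by simp
  have "\<exists>m'. exec row_offsets ?m2 (6 + 23 * r) m' \<and>
    (\<forall>i\<le>n. m' 5 i = i * n) \<and> (\<forall>a. a \<noteq> 5 \<and> a \<noteq> 6 \<longrightarrow> m' a = ?m2 a)"
    using Suc.prems by (intro Suc.IH) (auto simp: le_Suc_eq)
  then obtain m' where m': "exec row_offsets ?m2 (6 + 23 * r) m'" "\<forall>i\<le>n. m' 5 i = i * n"
    "\<forall>a. a \<noteq> 5 \<and> a \<noteq> 6 \<longrightarrow> m' a = ?m2 a" by blast
  have "exec row_offsets m (1 + expr_time ?b + (11 + 6) + (6 + 23 * r)) m'"
    using WhileTrue[OF test body] m'(1) unfolding row_offsets_def by blast
  moreover have "1 + expr_time ?b + (11 + 6) + (6 + 23 * r) = 6 + 23 * Suc r" by simp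
  moreover have "\<forall>a. a \<noteq> 5 \<and> a \<noteq> 6 \<longrightarrow> m' a = m a" using m'(3) by simp
  ultimately show ?case using m'(2) by (intro exI[of _ m']) simp
qed

text \<open>The terminals become the initial variables in the first \<open>2 * l\<close> cells of
  array 4, the row offsets are tabulated, and the result bit is moved to the answer cell. This adds
  only linear time.\<close>

lemma checkable_solvable:
  assumes Q: "checkable ((\<lambda>j (e :: nat list). e ! j) ` {..<2 * l}) Q"
    and I: "I \<subseteq> linkage_instances l"
  shows "\<exists>f. solvable_in_time encode_instance instance_order I
    (\<lambda>(G, ss, ts). Q G (ss @ ts)) (\<lambda>n. real n ^ f)"
proof -
  let ?acc = "\<lambda>j (e :: nat list). e ! j"
  let ?A = "?acc ` {..<2 * l}"
  \<comment> \<open>Variables are functions, so the index of an accessor is recovered by choosing a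
    preimage; any preimage reads the same entry.\<close>
  let ?loc = "inv_into {..<2 * l} ?acc"
  have loc: "?loc ` ?A \<subseteq> {..<2 * l}"
    using inv_into_into[of _ ?acc "{..<2 * l}"] by blast
  with Q obtain p T where pT: "poly_bounded T" "decides p T (2 * l) ?loc ?A Q" by (rule checkableE)
  let ?w = "Write 0 (Const 0) (Read 6 (Const 0))"
  let ?p = "Seq (copy_array 2 0 l) (Seq (copy_array 3 l l) (Seq row_offsets (Seq p ?w)))"
  let ?T = "\<lambda>n. 8 * l + 12 + 23 * n + T n"
  have run: "\<exists>u m. exec ?p (encode_instance (G, ss, ts)) u m \<and> u \<le> ?T (card (pverts G)) \<and>
      m 0 0 = of_bool (Q G (ss @ ts))" if x: "(G, ss, ts) \<in> I" for G ss ts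
  proof -
    let ?n = "card (pverts G)"
    have G: "input_graph G" and len: "length ss = l" "length ts = l"
      and sub: "set (ss @ ts) \<subseteq> pverts G"
      using x I by (auto simp: linkage_instances_def input_graph_def)
    define m0 where "m0 = encode_instance (G, ss, ts)"
    have m0: "m0 0 0 = ?n" "m0 6 = (\<lambda>_. 0)" "m0 5 = (\<lambda>_. 0)"
      "m0 1 = (\<lambda>j. of_bool (j < ?n * ?n \<and> (j div ?n, j mod ?n) \<in> parcs G))"
      "\<And>i. i < l \<Longrightarrow> m0 2 i = ss ! i" "\<And>i. i < l \<Longrightarrow> m0 3 i = ts ! i"
      using len by (simp_all add: m0_def Let_def)
    define m1 where "m1 = m0(4 := (\<lambda>j. if 0 \<le> j \<and> j < 0 + l then m0 2 (j - 0) else m0 4 j))"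
    define m2 where "m2 = m1(4 := (\<lambda>j. if l \<le> j \<and> j < l + l then m1 3 (j - l) else m1 4 j))"
    have e1: "exec (copy_array 2 0 l) m0 (1 + 4 * l) m1" unfolding m1_def by (rule exec_copy_array) simp
    have e2: "exec (copy_array 3 l l) m1 (1 + 4 * l) m2" unfolding m2_def by (rule exec_copy_array) simp
    have "\<exists>m'. exec row_offsets m2 (6 + 23 * ?n) m' \<and>
      (\<forall>i\<le>?n. m' 5 i = i * ?n) \<and> (\<forall>a. a \<noteq> 5 \<and> a \<noteq> 6 \<longrightarrow> m' a = m2 a)"
      by (rule exec_row_offsets) (simp_all add: m2_def m1_def m0)
    then obtain m3 where m3: "exec row_offsets m2 (6 + 23 * ?n) m3" "\<forall>i\<le>?n. m3 5 i = i * ?n"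
      "\<forall>a. a \<noteq> 5 \<and> a \<noteq> 6 \<longrightarrow> m3 a = m2 a" by blast
    have m3_m0: "m3 a = m0 a" if "a \<notin> {4, 5, 6}" for a
      using m3(3) that by (simp add: m2_def m1_def)
    have m3_4: "m3 4 j = (ss @ ts) ! j" if "j < 2 * l" for j
      using m3(3) that len m0(5)[of j] m0(6)[of "j - l"] by (simp add: m2_def m1_def nth_append)
    have "represents G m3"
      using m3(2) m0 by (simp add: represents_def Let_def m3_m0)
    moreover have "t (ss @ ts) \<in> pverts G \<and> m3 4 (?loc t) = t (ss @ ts)" if "t \<in> ?A" for t
    proof -
      have j: "?loc t < 2 * l" using loc that by blast
      have "t (ss @ ts) = ?acc (?loc t) (ss @ ts)" 
        using fun_cong[OF f_inv_into_f[OF that], of "ss @ ts"] by simp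
      moreover have "(ss @ ts) ! ?loc t \<in> set (ss @ ts)" using j len by (intro nth_mem) simp
      ultimately show ?thesis using m3_4[OF j] sub by auto
    qed
    ultimately have "stores G ?loc ?A (ss @ ts) m3" using G unfolding stores_def by blast
    with pT(2) obtain u m4 where m4: "exec p m3 u m4" "u \<le> T ?n"
      "m4 6 0 = of_bool (Q G (ss @ ts))" by (rule decidesE)
    let ?m5 = "m4(0 := (m4 0)(0 := m4 6 0))"
    have "exec ?w m4 4 ?m5" by (rule exec_Write) simp_all
    then have "exec ?p m0 ((1 + 4 * l) + ((1 + 4 * l) + ((6 + 23 * ?n) + (u + 4)))) ?m5"
      using e1 e2 m3(1) m4(1) by (intro Seq)
    moreover have "(1 + 4 * l) + ((1 + 4 * l) + ((6 + 23 * ?n) + (u + 4))) \<le> ?T ?n"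
      using m4(2) by simp
    moreover have "?m5 0 0 = of_bool (Q G (ss @ ts))" using m4(3) by simp
    ultimately show ?thesis unfolding m0_def[symmetric] by blast
  qed
  have "poly_bounded ?T" using pT(1) by (intro poly_bounded_intros)
  then obtain c where c: "(\<lambda>n. real (?T n)) \<in> O(\<lambda>n. real n ^ c)"
    using poly_bounded_bigo by blast
  have "solvable_in_time encode_instance instance_order I
    (\<lambda>(G, ss, ts). Q G (ss @ ts)) (\<lambda>n. real n ^ c)"
    unfolding solvable_in_time_def
  proof (intro exI[of _ ?p] exI[of _ ?T] conjI ballI c)
    fix x assume "x \<in> I"
    moreover obtain G ss ts where "x = (G, ss, ts)" by (cases x)
    ultimately show "\<exists>t m. exec ?p (encode_instance x) t m \<and> t \<le> ?T (instance_order x) \<and>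
        m 0 0 = of_bool (case x of (G, ss, ts) \<Rightarrow> Q G (ss @ ts))"
      using run by simp
  qed
  then show ?thesis by blast
qed

section \<open>A first-order description of Hamiltonian linkages\<close>

text \<open>Reachability in \<open>V - X\<close> as a bounded disjunction over the number
  \<open>m\<close> of vertices of a walk. Finite index sets and plain existential quantifiers are
  used throughout to match the closure rules for \<open>checkable\<close>.\<close>

definition short_path :: "nat \<Rightarrow> 'a set \<Rightarrow> ('a \<times> 'a) set \<Rightarrow> 'a set \<Rightarrow> 'a \<Rightarrow> 'a \<Rightarrow> bool" where
  "short_path k V E X u v \<longleftrightarrow> (\<exists>m\<in>{1..2 * k}. \<exists>w. (\<forall>i\<in>{..<m}. w i \<in> V) \<and>
     (\<forall>i\<in>{..<m}. \<forall>x\<in>X. w i \<noteq> x) \<and> w 0 = u \<and> w (m - 1) = v \<and>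
     (\<forall>i\<in>{..<m - 1}. (w i, w (Suc i)) \<in> E))"

text \<open>The first \<open>m\<close> entries of \<open>x\<close> list the deleted set, the entries
  \<open>m\<close> and \<open>Suc m\<close> are the two vertices to be separated. Repeated entries
  merely describe a smaller set.\<close>

definition robust_formula :: "nat \<Rightarrow> nat \<Rightarrow> 'a set \<Rightarrow> ('a \<times> 'a) set \<Rightarrow> 'a set \<Rightarrow> bool" where
  "robust_formula k c V E X \<longleftrightarrow> (\<forall>m\<in>{..c}. \<not> (\<exists>x. (\<forall>i\<in>{..<m + 2}. x i \<in> V) \<and>
     (\<forall>i\<in>{..<m}. x i \<noteq> x m \<and> x i \<noteq> x (Suc m)) \<and>
     short_path k V E X (x m) (x (Suc m)) \<and>
     \<not> short_path k V E (X \<union> x ` {..<m}) (x m) (x (Suc m))))"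

text \<open>Path \<open>i\<close> has \<open>ns ! i\<close> segments, and
  \<open>x (i, a, True)\<close> and \<open>x (i, a, False)\<close> are the first and last vertex of
  its segment \<open>a\<close>. The shape \<open>ns\<close> is kept apart so that only vertices are
  quantified.\<close>

definition skeleton_formula :: "nat \<Rightarrow> nat \<Rightarrow> nat list \<Rightarrow> 'a set \<Rightarrow> ('a \<times> 'a) set \<Rightarrow> 'a set \<Rightarrow>
    (nat \<Rightarrow> 'a) \<Rightarrow> (nat \<Rightarrow> 'a) \<Rightarrow> (nat \<times> nat \<times> bool \<Rightarrow> 'a) \<Rightarrow> bool" where
  "skeleton_formula k l ns V E X s t x \<longleftrightarrow>
     (\<forall>i\<in>{..<l}. x (i, 0, True) = s i \<and> x (i, ns ! i - 1, False) = t i \<and>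
        (\<forall>a\<in>{..<ns ! i - 1}. (x (i, a, False), x (i, Suc a, True)) \<in> E)) \<and>
     (\<forall>i\<in>{..<l}. \<forall>a\<in>{..<ns ! i}. x (i, a, True) = x (i, a, False) \<or>
        short_path k V E X (x (i, a, True)) (x (i, a, False))) \<and>
     (\<forall>i\<in>{..<l}. \<forall>j\<in>{..<l}. \<forall>a\<in>{..<ns ! i}. \<forall>b\<in>{..<ns ! j}. (i, a) \<noteq> (j, b) \<longrightarrow>
        (\<forall>g\<in>UNIV. \<forall>h\<in>UNIV. x (i, a, g) \<noteq> x (j, b, h))) \<and>
     \<not> (\<exists>z\<in>V. \<not> (\<exists>i\<in>{..<l}. \<exists>a\<in>{..<ns ! i}.
        x (i, a, True) = z \<and> x (i, a, False) = z \<or>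
        x (i, a, True) \<noteq> x (i, a, False) \<and> short_path k V E X z (x (i, a, True))))"

text \<open>The excluded set varies with the environment, but it is the image of a fixed finite set
  \<open>X\<close> of variables, so avoiding it is a fixed finite conjunction.\<close>

lemma checkable_short_path:
  assumes X: "finite X" "X \<subseteq> A" and uv: "u \<in> A" "v \<in> A"
  shows "checkable A (\<lambda>G e. short_path k (pverts G) (parcs G) ((\<lambda>t. t e) ` X) (u e) (v e))"
  unfolding short_path_def
proof (intro checkable_Bex checkable_ex_restricted_tuple)
  fix m assume m: "m \<in> {1..2 * k}"
  let ?A = "extend_vars A \<union> (\<lambda>i p. snd p i) ` {..<m} :: ('a \<times> (nat \<Rightarrow> nat) \<Rightarrow> nat) set"
  have "checkable ?A (\<lambda>G p. (\<forall>i\<in>{..<m}. \<forall>t\<in>X. \<not> snd p i = t (fst p)) \<and>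
     snd p 0 = u (fst p) \<and> snd p (m - 1) = v (fst p) \<and>
     (\<forall>i\<in>{..<m - 1}. (snd p i, snd p (Suc i)) \<in> parcs G))"
    using X uv m
    by (intro checkable_conj checkable_Ball checkable_not checkable_eq checkable_adj) auto
  then show "checkable ?A (\<lambda>G p. (\<forall>i\<in>{..<m}. \<forall>x\<in>(\<lambda>t. t (fst p)) ` X. snd p i \<noteq> x) \<and>
     snd p 0 = u (fst p) \<and> snd p (m - 1) = v (fst p) \<and>
     (\<forall>i\<in>{..<m - 1}. (snd p i, snd p (Suc i)) \<in> parcs G))"
    by simp
next
  fix m G e and x y :: "nat \<Rightarrow> nat"
  assume "m \<in> {1..2 * k}" and eq: "\<And>i. i \<in> {..<m} \<Longrightarrow> x i = y i"
  then have "x 0 = y 0" "x (m - 1) = y (m - 1)" by auto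
  moreover have "(\<forall>i\<in>{..<m}. \<forall>z\<in>(\<lambda>t. t e) ` X. x i \<noteq> z) \<longleftrightarrow> (\<forall>i\<in>{..<m}. \<forall>z\<in>(\<lambda>t. t e) ` X. y i \<noteq> z)"
    using eq by simp
  moreover have "(\<forall>i\<in>{..<m - 1}. (x i, x (Suc i)) \<in> parcs G) \<longleftrightarrow> (\<forall>i\<in>{..<m - 1}. (y i, y (Suc i)) \<in> parcs G)"
    using eq by simp
  ultimately show "((\<forall>i\<in>{..<m}. \<forall>z\<in>(\<lambda>t. t e) ` X. x i \<noteq> z) \<and> x 0 = u e \<and> x (m - 1) = v e \<and>
       (\<forall>i\<in>{..<m - 1}. (x i, x (Suc i)) \<in> parcs G)) =
     ((\<forall>i\<in>{..<m}. \<forall>z\<in>(\<lambda>t. t e) ` X. y i \<noteq> z) \<and> y 0 = u e \<and> y (m - 1) = v e \<and>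
       (\<forall>i\<in>{..<m - 1}. (y i, y (Suc i)) \<in> parcs G))"
    by simp
qed auto

lemma checkable_robust_formula:
  assumes X: "finite X" "X \<subseteq> A"
  shows "checkable A (\<lambda>G e. robust_formula k c (pverts G) (parcs G) ((\<lambda>t. t e) ` X))"
  unfolding robust_formula_def
proof (intro checkable_Ball checkable_not checkable_ex_restricted_tuple)
  fix m assume "m \<in> {..c}"
  let ?A = "extend_vars A \<union> (\<lambda>i p. snd p i) ` {..<m + 2} :: ('a \<times> (nat \<Rightarrow> nat) \<Rightarrow> nat) set"
  let ?X = "extend_vars X :: ('a \<times> (nat \<Rightarrow> nat) \<Rightarrow> nat) set"
  let ?Y = "?X \<union> (\<lambda>i p. snd p i) ` {..<m}"
  have X': "finite ?X" "?X \<subseteq> ?A" "finite ?Y" "?Y \<subseteq> ?A" using X by auto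
  have uv: "(\<lambda>p. snd p m) \<in> ?A" "(\<lambda>p. snd p (Suc m)) \<in> ?A" by auto
  have "checkable ?A (\<lambda>G p. (\<forall>i\<in>{..<m}. \<not> snd p i = snd p m \<and> \<not> snd p i = snd p (Suc m)) \<and>
     short_path k (pverts G) (parcs G) ((\<lambda>t. t p) ` ?X) (snd p m) (snd p (Suc m)) \<and>
     \<not> short_path k (pverts G) (parcs G) ((\<lambda>t. t p) ` ?Y) (snd p m) (snd p (Suc m)))"
    using uv
    by (intro checkable_conj checkable_Ball checkable_not checkable_eq
        checkable_short_path[OF X'(1,2) uv] checkable_short_path[OF X'(3,4) uv]) auto
  then show "checkable ?A (\<lambda>G p. (\<forall>i\<in>{..<m}. snd p i \<noteq> snd p m \<and> snd p i \<noteq> snd p (Suc m)) \<and>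
     short_path k (pverts G) (parcs G) ((\<lambda>t. t (fst p)) ` X) (snd p m) (snd p (Suc m)) \<and>
     \<not> short_path k (pverts G) (parcs G) ((\<lambda>t. t (fst p)) ` X \<union> snd p ` {..<m}) (snd p m) (snd p (Suc m)))"
    by (simp add: image_Un image_image)
next
  fix m G e and x y :: "nat \<Rightarrow> nat"
  assume eq: "\<And>i. i \<in> {..<m + 2} \<Longrightarrow> x i = y i"
  then have "x m = y m" "x (Suc m) = y (Suc m)" "x ` {..<m} = y ` {..<m}" by auto
  moreover have "(\<forall>i\<in>{..<m}. x i \<noteq> y m \<and> x i \<noteq> y (Suc m)) \<longleftrightarrow> (\<forall>i\<in>{..<m}. y i \<noteq> y m \<and> y i \<noteq> y (Suc m))"
    using eq by simp
  ultimately show "((\<forall>i\<in>{..<m}. x i \<noteq> x m \<and> x i \<noteq> x (Suc m)) \<and>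
     short_path k (pverts G) (parcs G) ((\<lambda>t. t e) ` X) (x m) (x (Suc m)) \<and>
     \<not> short_path k (pverts G) (parcs G) ((\<lambda>t. t e) ` X \<union> x ` {..<m}) (x m) (x (Suc m))) =
    ((\<forall>i\<in>{..<m}. y i \<noteq> y m \<and> y i \<noteq> y (Suc m)) \<and>
     short_path k (pverts G) (parcs G) ((\<lambda>t. t e) ` X) (y m) (y (Suc m)) \<and>
     \<not> short_path k (pverts G) (parcs G) ((\<lambda>t. t e) ` X \<union> y ` {..<m}) (y m) (y (Suc m)))"
    by simp
qed auto

lemma checkable_skeleton_formula:
  assumes X: "finite X" "X \<subseteq> A" and st: "\<And>i. i < l \<Longrightarrow> s i \<in> A" "\<And>i. i < l \<Longrightarrow> t i \<in> A"
    and y: "\<And>i a h. i < l \<Longrightarrow> a < ns ! i \<Longrightarrow> y (i, a, h) \<in> A"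
    and ns: "\<And>i. i < l \<Longrightarrow> 0 < ns ! i"
  shows "checkable A (\<lambda>G e. skeleton_formula k l ns (pverts G) (parcs G) ((\<lambda>t. t e) ` X)
    (\<lambda>i. s i e) (\<lambda>i. t i e) (\<lambda>q. y q e))"
proof -
  let ?B = "insert snd (extend_vars A) :: ('a \<times> nat \<Rightarrow> nat) set"
  let ?X = "extend_vars X :: ('a \<times> nat \<Rightarrow> nat) set"
  have X': "finite ?X" "?X \<subseteq> ?B" using X by auto
  have y': "(\<lambda>p. y (i, a, h) (fst p)) \<in> ?B" if "i < l" "a < ns ! i" for i a h
    using y[OF that] by auto
  have z: "snd \<in> ?B" by simp
  have "checkable ?B (\<lambda>G p. \<not> (\<exists>i\<in>{..<l}. \<exists>a\<in>{..<ns ! i}.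
        y (i, a, True) (fst p) = snd p \<and> y (i, a, False) (fst p) = snd p \<or>
        \<not> y (i, a, True) (fst p) = y (i, a, False) (fst p) \<and>
        short_path k (pverts G) (parcs G) ((\<lambda>t. t p) ` ?X) (snd p) (y (i, a, True) (fst p))))"
    using y' z
    by (intro checkable_conj checkable_disj checkable_Bex checkable_not checkable_eq
        checkable_short_path[OF X']) auto
  then have cover: "checkable A (\<lambda>G e. \<exists>z\<in>pverts G. \<not> (\<exists>i\<in>{..<l}. \<exists>a\<in>{..<ns ! i}.
        y (i, a, True) e = z \<and> y (i, a, False) e = z \<or>
        \<not> y (i, a, True) e = y (i, a, False) e \<and>
        short_path k (pverts G) (parcs G) ((\<lambda>t. t e) ` X) z (y (i, a, True) e)))"
    by (intro checkable_ex_vertex) (simp add: image_image)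
  have "checkable A (\<lambda>G e.
     (\<forall>i\<in>{..<l}. y (i, 0, True) e = s i e \<and> y (i, ns ! i - 1, False) e = t i e \<and>
        (\<forall>a\<in>{..<ns ! i - 1}. (y (i, a, False) e, y (i, Suc a, True) e) \<in> parcs G)) \<and>
     (\<forall>i\<in>{..<l}. \<forall>a\<in>{..<ns ! i}. y (i, a, True) e = y (i, a, False) e \<or>
        short_path k (pverts G) (parcs G) ((\<lambda>t. t e) ` X) (y (i, a, True) e) (y (i, a, False) e)) \<and>
     (\<forall>i\<in>{..<l}. \<forall>j\<in>{..<l}. \<forall>a\<in>{..<ns ! i}. \<forall>b\<in>{..<ns ! j}. (i, a) \<noteq> (j, b) \<longrightarrow>
        (\<forall>g\<in>UNIV. \<forall>h\<in>UNIV. \<not> y (i, a, g) e = y (j, b, h) e)) \<and>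
     \<not> (\<exists>z\<in>pverts G. \<not> (\<exists>i\<in>{..<l}. \<exists>a\<in>{..<ns ! i}.
        y (i, a, True) e = z \<and> y (i, a, False) e = z \<or>
        \<not> y (i, a, True) e = y (i, a, False) e \<and>
        short_path k (pverts G) (parcs G) ((\<lambda>t. t e) ` X) z (y (i, a, True) e))))"
    by (intro checkable_conj checkable_disj checkable_imp checkable_Ball checkable_not[OF cover]
        checkable_const checkable_not[OF checkable_eq] checkable_eq checkable_adj
        checkable_short_path[OF X])
      (simp_all add: y st ns)
  then show ?thesis unfolding skeleton_formula_def .
qed

section \<open>Meaning of the formulas in graphs of bounded independence number\<close>

context graph_of_independence
begin

text \<open>Any walk witnesses reachability; conversely \<open>reach_short_path\<close> supplies a
  witness within the length bound, which is where the bound on independent sets enters.\<close>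

lemma short_path_iff: "short_path k V E X u v \<longleftrightarrow> reach E (V - X) u v"
proof
  assume "short_path k V E X u v"
  then obtain m w where m: "m \<in> {1..2 * k}" and w: "\<forall>i\<in>{..<m}. w i \<in> V"
    "\<forall>i\<in>{..<m}. \<forall>x\<in>X. w i \<noteq> x" "w 0 = u" "w (m - 1) = v" "\<forall>i\<in>{..<m - 1}. (w i, w (Suc i)) \<in> E"
    unfolding short_path_def by blast
  have "reach E (V - X) (w 0) (w i)" if "i < m" for i
    using that
  proof (induction i)
    case 0
    then show ?case using w(1,2) by (auto intro!: reach_refl)
  next
    case (Suc i)
    have "(w i, w (Suc i)) \<in> E" using w(5) Suc.prems by simp
    then have "reach E (V - X) (w i) (w (Suc i))" using w(1,2) Suc.prems by (auto intro!: reach_edge)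
    moreover have "reach E (V - X) (w 0) (w i)" using Suc by simp
    ultimately show ?case by (blast intro: reach_trans)
  qed
  from this[of "m - 1"] show "reach E (V - X) u v" using m w(3,4) by simp
next
  assume "reach E (V - X) u v"
  then obtain xs where xs: "path_in E (V - X) u xs v" "length xs \<le> 2 * k"
    using reach_short_path[of "V - X" u v] by blast
  have ne: "xs \<noteq> []" using xs by (simp add: path_in_def)
  have nth: "xs ! i \<in> V - X" if "i < length xs" for i
    using nth_mem[OF that] xs(1) unfolding path_in_def by blast
  have "(xs ! i, xs ! Suc i) \<in> E" if "Suc i < length xs" for i
    using xs(1) that unfolding path_in_def by (metis successively_conv_nth)
  moreover have "length xs \<in> {1..2 * k}" using ne xs(2) by (cases xs) simp_all
  moreover have "xs ! 0 = u" "xs ! (length xs - 1) = v"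
    using xs(1) by (auto simp: path_in_def hd_conv_nth last_conv_nth)
  ultimately show "short_path k V E X u v" unfolding short_path_def
    using nth by (intro bexI[of _ "length xs"] exI[of _ "(!) xs"]) auto
qed

lemma robust_formula_iff: "robust_formula k c V E X \<longleftrightarrow> robust c (V - X)"
proof
  assume f: "robust_formula k c V E X"
  show "robust c (V - X)"
    unfolding robust_def
  proof (intro allI impI)
    fix B u v
    assume B: "card B \<le> c" "B \<subseteq> V" "u \<notin> B" "v \<notin> B" and uv: "reach E (V - X) u v"
    have "finite B" using B(2) finite_V by (rule finite_subset)
    then obtain b where b: "bij_betw b {0..<card B} B" using ex_bij_betw_nat_finite by blast
    then have b': "b ` {..<card B} = B" by (simp add: bij_betw_def lessThan_atLeast0)
    \<comment> \<open>\<open>B\<close> is enumerated by the positions below \<open>card B\<close>,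
      and \<open>u\<close> and \<open>v\<close> take the next two.\<close>
    define x where "x = b(card B := u, Suc (card B) := v)"
    have x: "x ` {..<card B} = B" "x (card B) = u" "x (Suc (card B)) = v"
      using b' by (auto simp: x_def image_def)
    have "x i \<in> V" if "i < card B + 2" for i
    proof (cases "i < card B")
      case True
      then show ?thesis using x(1) B(2) by blast
    next
      case False
      then have "i = card B \<or> i = Suc (card B)" using that by linarith
      then show ?thesis using x reach_in[OF uv] by auto
    qed
    moreover have "\<forall>i\<in>{..<card B}. x i \<noteq> x (card B) \<and> x i \<noteq> x (Suc (card B))"
    proof
      fix i assume "i \<in> {..<card B}"
      then have "x i \<in> B" using x(1) by blast
      then show "x i \<noteq> x (card B) \<and> x i \<noteq> x (Suc (card B))" using x(2,3) B(3,4) by auto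
    qed
    moreover have "short_path k V E X (x (card B)) (x (Suc (card B)))"
      using uv x by (simp add: short_path_iff)
    ultimately have "short_path k V E (X \<union> x ` {..<card B}) (x (card B)) (x (Suc (card B)))"
      using f B(1) unfolding robust_formula_def by blast
    then show "reach E (V - X - B) u v"
      using x by (simp add: short_path_iff Diff_eq Int_assoc)
  qed
next
  assume r: "robust c (V - X)"
  show "robust_formula k c V E X"
    unfolding robust_formula_def
  proof (intro ballI notI, elim exE conjE)
    fix m x
    assume m: "m \<in> {..c}" and x: "\<forall>i\<in>{..<m + 2}. x i \<in> V"
      "\<forall>i\<in>{..<m}. x i \<noteq> x m \<and> x i \<noteq> x (Suc m)"
      "short_path k V E X (x m) (x (Suc m))"
      "\<not> short_path k V E (X \<union> x ` {..<m}) (x m) (x (Suc m))"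
    have "card (x ` {..<m}) \<le> c" using card_image_le[of "{..<m}" x] m by simp
    moreover have "x ` {..<m} \<subseteq> V" using x(1) by auto
    moreover have "x m \<notin> x ` {..<m}" "x (Suc m) \<notin> x ` {..<m}" using x(2) by force+
    ultimately have "reach E (V - X - x ` {..<m}) (x m) (x (Suc m))"
      using r x(3) unfolding robust_def short_path_iff by blast
    then show False using x(4) by (simp add: short_path_iff Diff_eq Int_assoc)
  qed
qed

lemma skeleton_formula_iff:
  assumes sk: "\<And>i. i < l \<Longrightarrow> sk i = map (\<lambda>a. (x (i, a, True), x (i, a, False))) [0..<ns ! i]"
    and ns: "\<And>i. i < l \<Longrightarrow> 0 < ns ! i"
    and x: "\<And>i a h. i < l \<Longrightarrow> a < ns ! i \<Longrightarrow> x (i, a, h) \<in> V"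
  shows "skeleton_formula k l ns V E X ((!) ss) ((!) ts) x \<longleftrightarrow> skeleton X ss ts l sk"
proof -
  have 1: "(sk i \<noteq> [] \<and> fst (hd (sk i)) = ss ! i \<and> snd (last (sk i)) = ts ! i \<and>
        successively (\<lambda>p q. (snd p, fst q) \<in> E) (sk i)) \<longleftrightarrow>
      (x (i, 0, True) = ss ! i \<and> x (i, ns ! i - 1, False) = ts ! i \<and>
        (\<forall>a\<in>{..<ns ! i - 1}. (x (i, a, False), x (i, Suc a, True)) \<in> E))" if "i < l" for i
  proof -
    have "successively (\<lambda>p q. (snd p, fst q) \<in> E) (sk i) \<longleftrightarrow>
        (\<forall>a<ns ! i - 1. (x (i, a, False), x (i, Suc a, True)) \<in> E)"
      using ns[OF that] by (auto simp: sk[OF that] successively_conv_nth)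
    then show ?thesis
      using ns[OF that] by (auto simp: sk[OF that] hd_map last_map)
  qed
  have 2: "(\<forall>p\<in>set (sk i). P p) \<longleftrightarrow> (\<forall>a\<in>{..<ns ! i}. P (x (i, a, True), x (i, a, False)))"
    "(\<exists>p\<in>set (sk i). P p) \<longleftrightarrow> (\<exists>a\<in>{..<ns ! i}. P (x (i, a, True), x (i, a, False)))"
    if "i < l" for i P
    by (auto simp: sk[OF that])
  have 3: "length (sk i) = ns ! i" "a < ns ! i \<Longrightarrow> sk i ! a = (x (i, a, True), x (i, a, False))"
    if "i < l" for i a
    by (simp_all add: sk[OF that])
  have 4: "{fst (sk i ! a), snd (sk i ! a)} = range (\<lambda>h. x (i, a, h))" if "i < l" "a < ns ! i" for i a
    using that by (auto simp: 3 UNIV_bool)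
  have c1: "(\<forall>i\<in>{..<l}. x (i, 0, True) = ss ! i \<and> x (i, ns ! i - 1, False) = ts ! i \<and>
        (\<forall>a\<in>{..<ns ! i - 1}. (x (i, a, False), x (i, Suc a, True)) \<in> E)) \<longleftrightarrow>
      (\<forall>i<l. sk i \<noteq> [] \<and> fst (hd (sk i)) = ss ! i \<and> snd (last (sk i)) = ts ! i \<and>
        successively (\<lambda>p q. (snd p, fst q) \<in> E) (sk i))"
    using 1 by blast
  have c2: "(\<forall>i\<in>{..<l}. \<forall>a\<in>{..<ns ! i}. x (i, a, True) = x (i, a, False) \<or>
        short_path k V E X (x (i, a, True)) (x (i, a, False))) \<longleftrightarrow>
      (\<forall>i<l. \<forall>p\<in>set (sk i). fst p \<in> V \<and> (fst p = snd p \<or> reach E (V - X) (fst p) (snd p)))"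
    using x by (auto simp: 2 short_path_iff)
  have c3: "(\<forall>i\<in>{..<l}. \<forall>j\<in>{..<l}. \<forall>a\<in>{..<ns ! i}. \<forall>b\<in>{..<ns ! j}. (i, a) \<noteq> (j, b) \<longrightarrow>
        (\<forall>g\<in>UNIV. \<forall>h\<in>UNIV. x (i, a, g) \<noteq> x (j, b, h))) \<longleftrightarrow>
      (\<forall>i<l. \<forall>j<l. \<forall>a<length (sk i). \<forall>b<length (sk j). (i, a) \<noteq> (j, b) \<longrightarrow>
        {fst (sk i ! a), snd (sk i ! a)} \<inter> {fst (sk j ! b), snd (sk j ! b)} = {})"
    (is "?L \<longleftrightarrow> ?R")
  proof
    assume L: ?L
    show ?R
    proof (intro allI impI)
      fix i j a b
      assume "i < l" "j < l" "a < length (sk i)" "b < length (sk j)" "(i, a) \<noteq> (j, b)"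
      moreover from this have "x (i, a, g) \<noteq> x (j, b, h)" for g h using L 3(1) by simp
      ultimately show "{fst (sk i ! a), snd (sk i ! a)} \<inter> {fst (sk j ! b), snd (sk j ! b)} = {}"
        using 3(1) by (auto simp: 4)
    qed
  next
    assume R: ?R
    show ?L
    proof (intro ballI impI)
      fix i j a b g h
      assume *: "i \<in> {..<l}" "j \<in> {..<l}" "a \<in> {..<ns ! i}" "b \<in> {..<ns ! j}" "(i, a) \<noteq> (j, b)"
      then have "{fst (sk i ! a), snd (sk i ! a)} \<inter> {fst (sk j ! b), snd (sk j ! b)} = {}"
        using R 3(1) by simp
      then have "range (\<lambda>h. x (i, a, h)) \<inter> range (\<lambda>h. x (j, b, h)) = {}"
        using 4[of i a] 4[of j b] * by (simp only: lessThan_iff)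
      then show "x (i, a, g) \<noteq> x (j, b, h)" by blast
    qed
  qed
  have c4: "\<not> (\<exists>z\<in>V. \<not> (\<exists>i\<in>{..<l}. \<exists>a\<in>{..<ns ! i}.
        x (i, a, True) = z \<and> x (i, a, False) = z \<or>
        x (i, a, True) \<noteq> x (i, a, False) \<and> short_path k V E X z (x (i, a, True)))) \<longleftrightarrow>
      (\<forall>z\<in>V. \<exists>i<l. \<exists>p\<in>set (sk i).
        fst p = z \<and> snd p = z \<or> fst p \<noteq> snd p \<and> reach E (V - X) z (fst p))"
  proof -
    have "(\<exists>a\<in>{..<ns ! i}. x (i, a, True) = z \<and> x (i, a, False) = z \<or>
        x (i, a, True) \<noteq> x (i, a, False) \<and> short_path k V E X z (x (i, a, True))) \<longleftrightarrow>
      (\<exists>p\<in>set (sk i). fst p = z \<and> snd p = z \<or> fst p \<noteq> snd p \<and> reach E (V - X) z (fst p))"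
      if "i < l" for i z
      unfolding 2(2)[OF that] by (simp only: fst_conv snd_conv short_path_iff)
    then have "(\<exists>i\<in>{..<l}. \<exists>a\<in>{..<ns ! i}. x (i, a, True) = z \<and> x (i, a, False) = z \<or>
        x (i, a, True) \<noteq> x (i, a, False) \<and> short_path k V E X z (x (i, a, True))) \<longleftrightarrow>
      (\<exists>i<l. \<exists>p\<in>set (sk i). fst p = z \<and> snd p = z \<or> fst p \<noteq> snd p \<and> reach E (V - X) z (fst p))"
      for z unfolding Bex_def lessThan_iff by (rule ex_cong1[OF conj_cong[OF refl]])
    then show ?thesis by simp
  qed
  show ?thesis unfolding skeleton_formula_def skeleton_def c1 c2 c3 c4 ..
qed

end


text \<open>Terminals are read only below \<open>l\<close>, where reading from \<open>ss\<close> or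
  from \<open>ss @ ts\<close> makes no difference.\<close>

lemma skeleton_formula_cong:
  assumes "\<And>i. i < l \<Longrightarrow> s i = s' i" "\<And>i. i < l \<Longrightarrow> t i = t' i"
  shows "skeleton_formula k l ns V E X s t x \<longleftrightarrow> skeleton_formula k l ns V E X s' t' x"
  unfolding skeleton_formula_def using assms by simp

text \<open>
  A path meeting at most \<open>m\<close> vertices of the cut has at most \<open>2 * m + 1\<close> segments.
\<close>

definition segments_bound :: "nat \<Rightarrow> nat" where
  "segments_bound m = 2 * m + 1"

text \<open>The side condition of \<open>skeleton_sound\<close>, taken with equality: for a cut of
  size at most \<open>m\<close>, a skeleton with \<open>l\<close> paths has at most
  \<open>l * segments_bound m\<close> pairs.\<close>

definition robustness :: "nat \<Rightarrow> nat \<Rightarrow> nat \<Rightarrow> nat" where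
  "robustness k l m = l * segments_bound m * (2 * k + 3)"

text \<open>The growth condition of \<open>exists_robust_cut\<close>, taken with equality: a failure
  of robustness adds at most as many vertices as the robustness demanded for the present
  bound.\<close>

primrec cut_bound :: "nat \<Rightarrow> nat \<Rightarrow> nat \<Rightarrow> nat" where
  "cut_bound k l 0 = 0"
| "cut_bound k l (Suc j) = cut_bound k l j + robustness k l (cut_bound k l j)"

definition segment_ends :: "nat \<Rightarrow> nat list \<Rightarrow> (nat \<times> nat \<times> bool) set" where
  "segment_ends l ns = (SIGMA i:{..<l}. {..<ns ! i} \<times> UNIV)"

lemma finite_segment_ends: "finite (segment_ends l ns)"
  unfolding segment_ends_def by (intro finite_SigmaI finite_cartesian_product) auto

text \<open>
  For fixed \<open>k\<close> and \<open>l\<close>, the number of quantified vertices is bounded by a constant.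
\<close>

definition linkage_formula :: "nat \<Rightarrow> nat \<Rightarrow> 'a set \<Rightarrow> ('a \<times> 'a) set \<Rightarrow> (nat \<Rightarrow> 'a) \<Rightarrow> (nat \<Rightarrow> 'a) \<Rightarrow> bool" where
  "linkage_formula k l V E s t \<longleftrightarrow> (\<exists>j\<in>{..<k}. \<exists>m\<in>{..cut_bound k l j}.
     \<exists>a. (\<forall>i\<in>{..<m}. a i \<in> V) \<and>
       robust_formula k (robustness k l (cut_bound k l j)) V E (a ` {..<m}) \<and>
       (\<exists>ns\<in>{ns. set ns \<subseteq> {1..segments_bound (cut_bound k l j)} \<and> length ns = l}.
          \<exists>x\<in>segment_ends l ns \<rightarrow>\<^sub>E V. skeleton_formula k l ns V E (a ` {..<m}) s t x))"

text \<open>The choices of \<open>j\<close>, \<open>m\<close> and \<open>ns\<close> range over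
  finite sets depending on \<open>k\<close> and \<open>l\<close> only and are unrolled in the
  program; the cut and the segment ends are found by nested loops.\<close>

lemma checkable_linkage_formula:
  "checkable ((\<lambda>j (e :: nat list). e ! j) ` {..<2 * l})
     (\<lambda>G e. linkage_formula k l (pverts G) (parcs G) ((!) e) (\<lambda>i. e ! (l + i)))"
  (is "checkable ?A _")
  unfolding linkage_formula_def
proof (intro checkable_Bex checkable_ex_restricted_tuple)
  fix j m
  let ?B = "extend_vars ?A \<union> (\<lambda>i p. snd p i) ` {..<m} :: (nat list \<times> (nat \<Rightarrow> nat) \<Rightarrow> nat) set"
  let ?X = "(\<lambda>i p. snd p i) ` {..<m} :: (nat list \<times> (nat \<Rightarrow> nat) \<Rightarrow> nat) set"
  let ?N = "{ns. set ns \<subseteq> {1..segments_bound (cut_bound k l j)} \<and> length ns = l}"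
  let ?R = "\<lambda>G. robust_formula k (robustness k l (cut_bound k l j)) (pverts G) (parcs G)"
  have X: "finite ?X" "?X \<subseteq> ?B" by auto
  have img: "(\<lambda>t. t p) ` ?X = snd p ` {..<m}" for p by (simp add: image_image)
  have robust: "checkable ?B (\<lambda>G p. ?R G (snd p ` {..<m}))"
    using checkable_robust_formula[OF X] by (simp only: img)
  have "checkable ?B (\<lambda>G p. \<exists>x\<in>segment_ends l ns \<rightarrow>\<^sub>E pverts G.
      skeleton_formula k l ns (pverts G) (parcs G) (snd p ` {..<m}) ((!) (fst p)) (\<lambda>i. fst p ! (l + i)) x)"
    if ns: "ns \<in> ?N" for ns
  proof (rule checkable_ex_tuple[OF finite_segment_ends])
    let ?C = "extend_vars ?B \<union> (\<lambda>i p. snd p i) ` segment_ends l ns ::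
      ((nat list \<times> (nat \<Rightarrow> nat)) \<times> (nat \<times> nat \<times> bool \<Rightarrow> nat) \<Rightarrow> nat) set"
    let ?Y = "extend_vars ?X :: ((nat list \<times> (nat \<Rightarrow> nat)) \<times> (nat \<times> nat \<times> bool \<Rightarrow> nat) \<Rightarrow> nat) set"
    have Y: "finite ?Y" "?Y \<subseteq> ?C" using X by auto
    have term_mem: "(\<lambda>q. fst (fst q) ! i) \<in> ?C" if "i < 2 * l" for i
    proof -
      have "(\<lambda>e. e ! i) \<in> ?A" using that by blast
      from extend_varsI[OF this] have "(\<lambda>p. fst p ! i) \<in> ?B" by blast
      from extend_varsI[OF this] show ?thesis by blast
    qed
    have end_mem: "(\<lambda>q. snd q (i, a, h)) \<in> ?C" if "i < l" "a < ns ! i" for i a h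
      using that by (auto simp: segment_ends_def)
    have pos: "0 < ns ! i" if "i < l" for i
      using ns nth_mem[of i ns] that by fastforce
    have "checkable ?C (\<lambda>G q. skeleton_formula k l ns (pverts G) (parcs G) ((\<lambda>t. t q) ` ?Y)
        (\<lambda>i. fst (fst q) ! i) (\<lambda>i. fst (fst q) ! (l + i)) (\<lambda>z. snd q z))"
      by (rule checkable_skeleton_formula[OF Y]) (use term_mem end_mem pos in simp_all)
    then show "checkable ?C (\<lambda>G q. skeleton_formula k l ns (pverts G) (parcs G) (snd (fst q) ` {..<m})
        ((!) (fst (fst q))) (\<lambda>i. fst (fst q) ! (l + i)) (snd q))"
      by (simp add: image_image)
  qed
  then have "checkable ?B (\<lambda>G p. \<exists>ns\<in>?N. \<exists>x\<in>segment_ends l ns \<rightarrow>\<^sub>E pverts G.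
      skeleton_formula k l ns (pverts G) (parcs G) (snd p ` {..<m}) ((!) (fst p)) (\<lambda>i. fst p ! (l + i)) x)"
    by (intro checkable_Bex finite_lists_length_eq) auto
  with robust show "checkable ?B (\<lambda>G p. ?R G (snd p ` {..<m}) \<and>
    (\<exists>ns\<in>?N. \<exists>x\<in>segment_ends l ns \<rightarrow>\<^sub>E pverts G.
      skeleton_formula k l ns (pverts G) (parcs G) (snd p ` {..<m}) ((!) (fst p)) (\<lambda>i. fst p ! (l + i)) x))"
    by (rule checkable_conj)
next
  fix j m G and e :: "nat list" and a b :: "nat \<Rightarrow> nat"
  assume "\<And>i. i \<in> {..<m} \<Longrightarrow> a i = b i"
  then have eq: "a ` {..<m} = b ` {..<m}" by simp
  show "(robust_formula k (robustness k l (cut_bound k l j)) (pverts G) (parcs G) (a ` {..<m}) \<and>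
       (\<exists>ns\<in>{ns. set ns \<subseteq> {1..segments_bound (cut_bound k l j)} \<and> length ns = l}.
          \<exists>x\<in>segment_ends l ns \<rightarrow>\<^sub>E pverts G. skeleton_formula k l ns (pverts G) (parcs G)
            (a ` {..<m}) ((!) e) (\<lambda>i. e ! (l + i)) x)) =
    (robust_formula k (robustness k l (cut_bound k l j)) (pverts G) (parcs G) (b ` {..<m}) \<and>
       (\<exists>ns\<in>{ns. set ns \<subseteq> {1..segments_bound (cut_bound k l j)} \<and> length ns = l}.
          \<exists>x\<in>segment_ends l ns \<rightarrow>\<^sub>E pverts G. skeleton_formula k l ns (pverts G) (parcs G)
            (b ` {..<m}) ((!) e) (\<lambda>i. e ! (l + i)) x))"
    unfolding eq ..
qed auto

lemma (in graph_of_independence) linkage_formula_iff: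
  "linkage_formula k l V E ((!) ss) ((!) ts) \<longleftrightarrow> (\<exists>P. hamiltonian_paths ss ts l P)"
proof
  assume "linkage_formula k l V E ((!) ss) ((!) ts)"
  then obtain j m a ns x where jm: "j < k" "m \<le> cut_bound k l j" and a: "\<forall>i\<in>{..<m}. a i \<in> V"
    and rob: "robust_formula k (robustness k l (cut_bound k l j)) V E (a ` {..<m})"
    and ns: "set ns \<subseteq> {1..segments_bound (cut_bound k l j)}" "length ns = l"
    and x: "x \<in> segment_ends l ns \<rightarrow>\<^sub>E V"
    and f: "skeleton_formula k l ns V E (a ` {..<m}) ((!) ss) ((!) ts) x"
    unfolding linkage_formula_def by blast
  define sk where "sk i = map (\<lambda>a. (x (i, a, True), x (i, a, False))) [0..<ns ! i]" for i
  have ns': "0 < ns ! i" "ns ! i \<le> segments_bound (cut_bound k l j)" if "i < l" for i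
    using ns nth_mem[of i ns] that by fastforce+
  have "x (i, b, h) \<in> V" if "i < l" "b < ns ! i" for i b h
    using x that by (auto simp: segment_ends_def)
  then have "skeleton (a ` {..<m}) ss ts l sk"
    using skeleton_formula_iff[of l sk x ns] f sk_def ns'(1) by blast
  moreover have "a ` {..<m} \<subseteq> V" using a by auto
  moreover have "robust (robustness k l (cut_bound k l j)) (V - a ` {..<m})"
    using rob by (simp add: robust_formula_iff)
  moreover have "length (sk i) \<le> segments_bound (cut_bound k l j)" if "i < l" for i
    using ns'(2)[OF that] by (simp add: sk_def)
  ultimately show "\<exists>P. hamiltonian_paths ss ts l P"
    by (rule skeleton_sound) (simp_all add: robustness_def)
next
  assume "\<exists>P. hamiltonian_paths ss ts l P"
  then obtain P where P: "hamiltonian_paths ss ts l P" by blast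
  have "\<exists>j<k. \<exists>A\<subseteq>V. card A \<le> cut_bound k l j \<and> robust (robustness k l (cut_bound k l j)) (V - A)"
    by (rule exists_robust_cut) simp
  then obtain j A where j: "j < k" and A: "A \<subseteq> V" "card A \<le> cut_bound k l j"
    and rob: "robust (robustness k l (cut_bound k l j)) (V - A)" by blast
  have "finite A" using A(1) finite_V by (rule finite_subset)
  then obtain a where "bij_betw a {0..<card A} A" using ex_bij_betw_nat_finite by blast
  then have a: "a ` {..<card A} = A" by (simp add: bij_betw_def lessThan_atLeast0)
  obtain sk where sk: "skeleton A ss ts l sk" and len: "\<forall>i<l. length (sk i) \<le> 2 * card A + 1"
    using skeleton_complete[OF P A(1)] by blast
  define ns where "ns = map (\<lambda>i. length (sk i)) [0..<l]"
  \<comment> \<open>The restriction puts the ends of the segments into the extensional function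
    space searched by the formula.\<close>
  define x where "x = restrict (\<lambda>(i, a, h). if h then fst (sk i ! a) else snd (sk i ! a)) (segment_ends l ns)"
  have ns: "ns ! i = length (sk i)" if "i < l" for i using that by (simp add: ns_def)
  have pos: "0 < ns ! i" if "i < l" for i
    using sk that unfolding skeleton_def by (simp add: ns)
  have x_eq: "x (i, b, h) = (if h then fst (sk i ! b) else snd (sk i ! b))" if "i < l" "b < ns ! i" for i b h
    using that by (simp add: x_def segment_ends_def)
  have x_V: "x (i, b, h) \<in> V" if "i < l" "b < ns ! i" for i b h
  proof -
    have "sk i ! b \<in> set (sk i)" using that ns by simp
    then have "fst (sk i ! b) \<in> V" "fst (sk i ! b) = snd (sk i ! b) \<or>
        reach E (V - A) (fst (sk i ! b)) (snd (sk i ! b))"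
      using sk that(1) unfolding skeleton_def by blast+
    then show ?thesis using x_eq[OF that] by (auto dest: reach_in)
  qed
  have sk_eq: "sk i = map (\<lambda>b. (x (i, b, True), x (i, b, False))) [0..<ns ! i]" if "i < l" for i
    using that by (intro nth_equalityI) (simp_all add: ns x_eq)
  have f: "skeleton_formula k l ns V E (a ` {..<card A}) ((!) ss) ((!) ts) x"
    using skeleton_formula_iff[OF sk_eq pos x_V] sk a by simp
  have "x \<in> segment_ends l ns \<rightarrow>\<^sub>E V"
    using x_V by (auto simp: segment_ends_def x_def)
  moreover have "set ns \<subseteq> {1..segments_bound (cut_bound k l j)}"
  proof
    fix n assume "n \<in> set ns"
    then obtain i where i: "i < l" "n = ns ! i" by (auto simp: ns_def)
    have "length (sk i) \<le> 2 * card A + 1" using len i(1) by blast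
    then show "n \<in> {1..segments_bound (cut_bound k l j)}"
      using pos[OF i(1)] A(2) ns[OF i(1)] i(2) by (simp add: segments_bound_def Suc_le_eq)
  qed
  moreover have "length ns = l" by (simp add: ns_def)
  moreover have "\<forall>i\<in>{..<card A}. a i \<in> V" using a A(1) by blast
  moreover have "robust_formula k (robustness k l (cut_bound k l j)) V E (a ` {..<card A})"
    using rob a by (simp add: robust_formula_iff)
  ultimately show "linkage_formula k l V E ((!) ss) ((!) ts)"
    unfolding linkage_formula_def using j A(2) f by blast
qed

section \<open>The formula decides Hamiltonian linkages of input graphs\<close>

lemma vwalk_arcs_chain: "set (vwalk_arcs xs) \<subseteq> E \<longleftrightarrow> chain E xs"
  by (induction xs rule: vwalk_arcs.induct) auto

lemma solvable_in_time_cong: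
  assumes "\<And>x. x \<in> I \<Longrightarrow> Q x \<longleftrightarrow> Q' x"
  shows "solvable_in_time encode sz I Q g \<longleftrightarrow> solvable_in_time encode sz I Q' g"
  unfolding solvable_in_time_def using assms by (simp cong: ball_cong)

theorem theorem6:
  fixes k l :: nat
  assumes "k > 0" and "l > 0"
  shows "\<exists>f :: nat.
    solvable_in_time encode_instance instance_order
      {(G, ss, ts). (G, ss, ts) \<in> linkage_instances l \<and> independence_number G < k}
      (\<lambda>(G, ss, ts). hamiltonian_linkage G ss ts)
      (\<lambda>n. real n ^ f)"
proof -
  let ?I = "{(G, ss, ts). (G, ss, ts) \<in> linkage_instances l \<and> independence_number G < k}"
  let ?Q = "\<lambda>G e. linkage_formula k l (pverts G) (parcs G) ((!) e) (\<lambda>i. e ! (l + i))"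
  have correct: "?Q G (ss @ ts) \<longleftrightarrow> hamiltonian_linkage G ss ts" if x: "(G, ss, ts) \<in> ?I" for G ss ts
  proof -
    have G: "pair_graph G" and len: "length ss = l" "length ts = l"
      and indep: "independence_number G < k"
      using x by (auto simp: linkage_instances_def)
    interpret pair_graph G by (fact G)
    interpret graph_of_independence "pverts G" "parcs G" k
    proof
      show "finite (pverts G)" by (fact pair_finite_verts)
      show "sym (parcs G)" by (rule symI) (rule arcs_symmetric)
      show "(u, u) \<notin> parcs G" for u using pair_no_loops[of "(u, u)"] by auto
      fix S assume S: "S \<subseteq> pverts G" "\<And>u v. u \<in> S \<Longrightarrow> v \<in> S \<Longrightarrow> (u, v) \<notin> parcs G"
      have "{S. independent_set G S} \<subseteq> Pow (pverts G)" by (auto simp: independent_set_def)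
      then have "finite {S. independent_set G S}"
        using pair_finite_verts by (meson finite_Pow_iff finite_subset)
      moreover have "independent_set G S" using S by (simp add: independent_set_def)
      ultimately have "card S \<le> independence_number G"
        unfolding independence_number_def by (intro Max_ge) auto
      then show "card S < k" using indep by simp
    qed
    have "?Q G (ss @ ts) \<longleftrightarrow> linkage_formula k l (pverts G) (parcs G) ((!) ss) ((!) ts)"
      unfolding linkage_formula_def
      using len by (simp add: nth_append cong: skeleton_formula_cong)
    also have "\<dots> \<longleftrightarrow> (\<exists>P. hamiltonian_paths ss ts l P)" by (rule linkage_formula_iff)
    also have "\<dots> \<longleftrightarrow> hamiltonian_linkage G ss ts"
    proof -
      have "vpath xs (with_proj G) \<and> hd xs = u \<and> last xs = v \<longleftrightarrow> path_in (parcs G) (pverts G) u xs v"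
        for xs u v
        by (auto simp: vpath_def vwalk_def path_in_def vwalk_arcs_chain)
      then show ?thesis unfolding hamiltonian_linkage_def hamiltonian_paths_def len(1) by simp
    qed
    finally show ?thesis .
  qed
  have "?I \<subseteq> linkage_instances l" by auto
  from checkable_solvable[OF checkable_linkage_formula this]
  obtain f where "solvable_in_time encode_instance instance_order ?I
    (\<lambda>(G, ss, ts). ?Q G (ss @ ts)) (\<lambda>n. real n ^ f)" by blast
  moreover have "(case x of (G, ss, ts) \<Rightarrow> ?Q G (ss @ ts)) \<longleftrightarrow>
      (case x of (G, ss, ts) \<Rightarrow> hamiltonian_linkage G ss ts)" if "x \<in> ?I" for x
    using that correct by (cases x) simp
  ultimately have "solvable_in_time encode_instance instance_order ?I
    (\<lambda>(G, ss, ts). hamiltonian_linkage G ss ts) (\<lambda>n. real n ^ f)"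
    using solvable_in_time_cong[of ?I "\<lambda>(G, ss, ts). ?Q G (ss @ ts)"] by blast
  then show ?thesis by blast
qed

end
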